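(* Let $d\ge 1$, $m>0$, $\varkappa>0$, $0\le a\in L^1(\mathbb{R}^d)$ with $\int_{\mathbb{R}^d}a(x)\,dx=1$, let $E$ be one of the spaces $C_{ub}(\mathbb{R}^d)$, $C_b(\mathbb{R}^d)$, $L^\infty(\mathbb{R}^d)$, let $G:E\to E$ and $\theta>0$. Assume that conditions (1)–(4) below hold for $(a,\varkappa,G,\theta)$. Assume moreover that for each $n\in\mathbb{N}$ there exist $0\le a_n\in L^1(\mathbb{R}^d)$, $\varkappa_n>0$, $G_n:E\to E$ and $\theta_n\in(0,\theta]$ which satisfy all the conditions (1)–(10) below in place of $a$, $\varkappa$, $G$, $\theta$, respectively (with the same $m$), and such that, with $\mathfrak m_n:=\varkappa_n\int_{\mathbb{R}^d}x\,a_n(x)\,dx\in\mathbb{R}^d$, $$\theta_n\ge\theta-\frac1n,\qquad \varkappa_n a_n*w-w\,G_nw\le\varkappa\, a*w-w\,Gw\quad\text{for all } w\in E_{\theta_n}^+ .$$ The conditions on $(a,\varkappa,G,\theta)$ are: (1) $\beta:=\varkappa-m>0$; (2) $0=G0\le Gv\le G\theta=\beta$ for all $v\in E_\theta^+$; (3) there exists $l_\theta>0$ such that $\|Gv-Gw\|_E\le l_\theta\|v-w\|_E$ for all $v,w\in E_\theta^+$; (4) for some $p\ge 0$ and all $v,w\in E_\theta^+$ with $v\le w$, one has $\varkappa\, a*v-v\,Gv+pv\le \varkappa\, a*w-w\,Gw+pw$; (5) there exists $\varrho>0$ such that $a(x)\ge\varrho$ for a.a. $x\in B_\varrho(0)$;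 (6) for any $v_n,v\in E_\theta^+$ such that $v_n\to v$ locally uniformly, one has $Gv_n\to Gv$ locally uniformly; (7) $T_yGv=GT_yv$ for all $v\in E_\theta^+$, $y\in\mathbb{R}^d$; (8) $Gr<\beta$ for every constant $r\in(0,\theta)$; (9) $\int_{\mathbb{R}^d}|y|\,a(y)\,dy<\infty$; (10) there exist $q\ge0$, $\delta>0$ and $0\le b\in C^\infty(\mathbb{R}^d)\cap L^\infty(\mathbb{R}^d)$ such that $a(x)-b(x)\ge\delta\,\mathbf 1_{B_\delta(0)}(x)$ for $x\in\mathbb{R}^d$, and $w\,Gw\le\varkappa\, b*w+qw$ for all $w\in E_\theta^+$. Let $u_0\in E_\theta^+$, $u_0\not\equiv0$, and let $u$ be the corresponding solution to $$\frac{\partial u}{\partial t}(x,t)=\varkappa(a*u)(x,t)-m\,u(x,t)-u(x,t)(Gu)(x,t),\quad t>0,\qquad u(x,0)=u_0(x).$$ Then, for any compact set $K\subset\mathbb{R}^d$ and any $n\in\mathbb{N}$, $$\theta-\frac1n\le\liminf_{t\to\infty}\operatorname*{ess\,inf}_{x\in K}u(x+t\mathfrak m_n,t)\le\limsup_{t\to\infty}\operatorname*{ess\,inf}_{x\in K}u(x+t\mathfrak m_n,t)\le\theta .$$ In particular, if for some $\widetilde{\mathfrak m}\in\mathbb{R}^d$ and $n_0\in\mathbb{N}$ one has $\mathfrak m_n=\widetilde{\mathfrak m}$ for all $n\ge n_0$, then $$\lim_{t\to\infty}\operatorname*{ess\,inf}_{x\in K}u(x+t\widetilde{\mathfrak m},t)=\theta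 .$$
   Context: $C_{ub}(\mathbb{R}^d)$ and $C_b(\mathbb{R}^d)$ are the spaces of bounded uniformly continuous, respectively bounded continuous, real functions with the sup-norm; $L^\infty(\mathbb{R}^d)$ has the esssup-norm. Inequalities between elements of $E$ are pointwise (a.e. if $E=L^\infty$). For $r>0$, $E_r^+:=\{v\in E:0\le v\le r\}$. Constants are identified with constant functions. $(a*u)(x,t)=\int_{\mathbb{R}^d}a(x-y)u(y,t)\,dy$; $(Gu)(x,t)$ means $(G u(\cdot,t))(x)$; $(T_yv)(x)=v(x-y)$; $B_r(x_0)$ is the ball of radius $r$ centered at $x_0$. Locally uniform convergence means uniform convergence on compact subsets of $\mathbb{R}^d$. Under (7), $Gr$ is a constant function for every constant $r\in(0,\theta)$. When the conditions are imposed on $(a_n,\varkappa_n,G_n,\theta_n)$, the number $\beta$ is replaced by $\varkappa_n-m$. A classical solution on $\mathbb{R}_+=[0,\infty)$ is a function $u\in C([0,\infty)\to E)\cap C^1((0,\infty)\to E)$ which satisfies the equation for $t>0$ and $u(\cdot,0)=u_0$ in $E$. Under (1)–(4), for every $u_0\in E_\theta^+$ there is a unique classical solution on $\mathbb{R}_+$ with $0\le u(x,t)\le\theta$; this is "the corresponding solution". The condition $u_0\not\equiv0$: if $E$ consists of continuous functions, $u_0$ is not identically zero; if $E=L^\infty(\mathbb{R}^d)$, it means that there exist $\delta>0$ and $x_0\in\mathbb{R}^d$ such that $u_0(x)\ge\delta$ for a.a. $x\in B_\delta(x_0)$.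
   Formalization: The approximating kernels a_n are also assumed to have integral 1, without which the claim fails; K is assumed non-null if E is L^∞ and nonempty otherwise, so that the infimum over K is not +∞. *)

theory Defs
  imports "HOL-Analysis.Analysis" "HOL-Probability.Essential_Supremum"
begin

section \<open>The function spaces\<close>

text \<open>
  The three admissible spaces \<open>E\<close> are handled uniformly: an element of \<open>E\<close> is represented by a
  function on \<open>real ^ 'd\<close>. For \<open>L\<^sup>\<infinity>\<close> functions are representatives of their classes modulo
  equality almost everywhere, so everything below is stated up to \<open>eqE Linf\<close>. Since every class of
  Lebesgue measurable functions has a Borel representative, and \<open>AE x in lborel\<close> allows
  arbitrary subsets of Borel null sets as exceptional sets, \<open>lborel\<close> gives the usual
  \<open>L\<^sup>1\<close> and \<open>L\<^sup>\<infinity>\<close>.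
\<close>

datatype space_kind = Cub | Cb | Linf

fun space_E :: "space_kind \<Rightarrow> (real ^ 'd \<Rightarrow> real) set" where
  "space_E Cub = {v. uniformly_continuous_on UNIV v \<and> bounded (range v)}"
| "space_E Cb = {v. continuous_on UNIV v \<and> bounded (range v)}"
| "space_E Linf = {v \<in> borel_measurable lborel. \<exists>C. AE x in lborel. \<bar>v x\<bar> \<le> C}"

fun norm_E :: "space_kind \<Rightarrow> (real ^ 'd \<Rightarrow> real) \<Rightarrow> real" where
  "norm_E Linf v = real_of_ereal (esssup lborel (\<lambda>x. ereal \<bar>v x\<bar>))"
| "norm_E _ v = (SUP x. \<bar>v x\<bar>)"

text \<open>
  The sense in which pointwise relations between elements of \<open>E\<close> are understood: everywhere for
  continuous functions, almost everywhere for \<open>L\<^sup>\<infinity>\<close>.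
\<close>

fun holds_E :: "space_kind \<Rightarrow> (real ^ 'd \<Rightarrow> bool) \<Rightarrow> bool" where
  "holds_E Linf P \<longleftrightarrow> (AE x in lborel. P x)"
| "holds_E _ P \<longleftrightarrow> (\<forall>x. P x)"

definition eqE :: "space_kind \<Rightarrow> (real ^ 'd \<Rightarrow> real) \<Rightarrow> (real ^ 'd \<Rightarrow> real) \<Rightarrow> bool" where
  "eqE k v w \<longleftrightarrow> holds_E k (\<lambda>x. v x = w x)"

definition leE :: "space_kind \<Rightarrow> (real ^ 'd \<Rightarrow> real) \<Rightarrow> (real ^ 'd \<Rightarrow> real) \<Rightarrow> bool" where
  "leE k v w \<longleftrightarrow> holds_E k (\<lambda>x. v x \<le> w x)"

definition E_plus :: "space_kind \<Rightarrow> real \<Rightarrow> (real ^ 'd \<Rightarrow> real) set" where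
  "E_plus k r = {v \<in> space_E k. leE k (\<lambda>x. 0) v \<and> leE k v (\<lambda>x. r)}"

text \<open>Compatibility with \<open>eqE\<close> makes \<open>G\<close> a map on classes when \<open>E = L\<^sup>\<infinity>\<close>.\<close>

definition maps_E :: "space_kind \<Rightarrow> ((real ^ 'd \<Rightarrow> real) \<Rightarrow> real ^ 'd \<Rightarrow> real) \<Rightarrow> bool" where
  "maps_E k G \<longleftrightarrow> (\<forall>v \<in> space_E k. G v \<in> space_E k) \<and>
     (\<forall>v \<in> space_E k. \<forall>w \<in> space_E k. eqE k v w \<longrightarrow> eqE k (G v) (G w))"

definition loc_unif_conv ::
  "space_kind \<Rightarrow> (nat \<Rightarrow> real ^ 'd \<Rightarrow> real) \<Rightarrow> (real ^ 'd \<Rightarrow> real) \<Rightarrow> bool" where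
  "loc_unif_conv k vs v \<longleftrightarrow>
     (\<forall>K. compact K \<longrightarrow>
       (\<forall>e>0. \<forall>\<^sub>F n in sequentially. holds_E k (\<lambda>x. x \<in> K \<longrightarrow> dist (vs n x) (v x) < e)))"

fun not_identically_zero :: "space_kind \<Rightarrow> (real ^ 'd \<Rightarrow> real) \<Rightarrow> bool" where
  "not_identically_zero Linf v \<longleftrightarrow>
     (\<exists>\<delta>>0. \<exists>x0. AE x in lborel. x \<in> ball x0 \<delta> \<longrightarrow> v x \<ge> \<delta>)"
| "not_identically_zero _ v \<longleftrightarrow> (\<exists>x. v x \<noteq> 0)"

text \<open>
  Like inequalities in \<open>E\<close>, the essential infimum ignores null sets only when \<open>E = L\<^sup>\<infinity>\<close>;
  for continuous functions it is the infimum over \<open>K\<close>. The infimum is at most the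
  measure-theoretic essential infimum over \<open>K\<close>, so lower bounds for it are the stronger ones, and
  it is also meaningful on nonempty null sets such as single points.
\<close>

fun ess_inf_on :: "space_kind \<Rightarrow> (real ^ 'd) set \<Rightarrow> (real ^ 'd \<Rightarrow> real) \<Rightarrow> ereal" where
  "ess_inf_on Linf K f = - esssup (restrict_space lborel K) (\<lambda>x. ereal (- f x))"
| "ess_inf_on _ K f = (INF x\<in>K. ereal (f x))"

text \<open>
  The sets on which \<open>ess_inf_on\<close> is not the infimum of the empty set, which would be \<open>\<infinity>\<close>.
\<close>

fun nonnegligible :: "space_kind \<Rightarrow> (real ^ 'd) set \<Rightarrow> bool" where
  "nonnegligible Linf K \<longleftrightarrow> emeasure lborel K > 0"
| "nonnegligible _ K \<longleftrightarrow> K \<noteq> {}"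


section \<open>Kernels\<close>

text \<open>
  The normalisation is a standing assumption on \<open>a\<close> and is also required of the approximating
  kernels: \<open>\<theta>\<^sub>n\<close> is a stationary solution of the approximating equation only if \<open>a\<^sub>n\<close> has
  integral 1.
\<close>

definition prob_kernel :: "(real ^ 'd \<Rightarrow> real) \<Rightarrow> bool" where
  "prob_kernel a \<longleftrightarrow> integrable lborel a \<and> (AE x in lborel. 0 \<le> a x) \<and> (LINT x|lborel. a x) = 1"

definition conv :: "(real ^ 'd \<Rightarrow> real) \<Rightarrow> (real ^ 'd \<Rightarrow> real) \<Rightarrow> real ^ 'd \<Rightarrow> real" where
  "conv a v x = (LINT y|lborel. a (x - y) * v y)"

definition shift :: "real ^ 'd \<Rightarrow> (real ^ 'd \<Rightarrow> real) \<Rightarrow> real ^ 'd \<Rightarrow> real" where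
  "shift y v x = v (x - y)"

definition drift :: "(real ^ 'd \<Rightarrow> real) \<Rightarrow> real \<Rightarrow> real ^ 'd" where
  "drift a \<kappa> = \<kappa> *\<^sub>R (LINT x|lborel. a x *\<^sub>R x)"

text \<open>
  \<open>C_diff j f\<close>: the function \<open>f\<close> is of class \<open>C\<^sup>j\<close>, by recursion on the partial derivatives
  (continuous differentiability is differentiability with continuous partial derivatives).
\<close>

primrec C_diff :: "nat \<Rightarrow> (real ^ 'd \<Rightarrow> real) \<Rightarrow> bool" where
  "C_diff 0 f \<longleftrightarrow> continuous_on UNIV f"
| "C_diff (Suc j) f \<longleftrightarrow> f differentiable_on UNIV \<and>
     (\<forall>i. C_diff j (\<lambda>x. frechet_derivative f (at x) (axis i 1)))"

definition C_infinity :: "(real ^ 'd \<Rightarrow> real) \<Rightarrow> bool" where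
  "C_infinity f \<longleftrightarrow> (\<forall>j. C_diff j f)"


section \<open>The conditions on the data\<close>

definition reaction ::
  "(real ^ 'd \<Rightarrow> real) \<Rightarrow> real \<Rightarrow> ((real ^ 'd \<Rightarrow> real) \<Rightarrow> real ^ 'd \<Rightarrow> real)
     \<Rightarrow> (real ^ 'd \<Rightarrow> real) \<Rightarrow> real ^ 'd \<Rightarrow> real" where
  "reaction a \<kappa> G w x = \<kappa> * conv a w x - w x * G w x"

definition G_range ::
  "space_kind \<Rightarrow> real \<Rightarrow> real \<Rightarrow> ((real ^ 'd \<Rightarrow> real) \<Rightarrow> real ^ 'd \<Rightarrow> real) \<Rightarrow> real \<Rightarrow> bool" where
  "G_range k m \<kappa> G \<theta> \<longleftrightarrow>
     eqE k (G (\<lambda>x. 0)) (\<lambda>x. 0) \<and>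
     (\<forall>v \<in> E_plus k \<theta>. leE k (\<lambda>x. 0) (G v) \<and> leE k (G v) (G (\<lambda>x. \<theta>))) \<and>
     eqE k (G (\<lambda>x. \<theta>)) (\<lambda>x. \<kappa> - m)"

definition G_lipschitz ::
  "space_kind \<Rightarrow> ((real ^ 'd \<Rightarrow> real) \<Rightarrow> real ^ 'd \<Rightarrow> real) \<Rightarrow> real \<Rightarrow> bool" where
  "G_lipschitz k G \<theta> \<longleftrightarrow>
     (\<exists>l>0. \<forall>v \<in> E_plus k \<theta>. \<forall>w \<in> E_plus k \<theta>.
        norm_E k (\<lambda>x. G v x - G w x) \<le> l * norm_E k (\<lambda>x. v x - w x))"

definition quasi_monotone ::
  "space_kind \<Rightarrow> (real ^ 'd \<Rightarrow> real) \<Rightarrow> real \<Rightarrow> ((real ^ 'd \<Rightarrow> real) \<Rightarrow> real ^ 'd \<Rightarrow> real)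
     \<Rightarrow> real \<Rightarrow> bool" where
  "quasi_monotone k a \<kappa> G \<theta> \<longleftrightarrow>
     (\<exists>p\<ge>0. \<forall>v \<in> E_plus k \<theta>. \<forall>w \<in> E_plus k \<theta>. leE k v w \<longrightarrow>
        leE k (\<lambda>x. reaction a \<kappa> G v x + p * v x) (\<lambda>x. reaction a \<kappa> G w x + p * w x))"

definition positive_near_0 :: "(real ^ 'd \<Rightarrow> real) \<Rightarrow> bool" where
  "positive_near_0 a \<longleftrightarrow> (\<exists>\<rho>>0. AE x in lborel. x \<in> ball 0 \<rho> \<longrightarrow> a x \<ge> \<rho>)"

definition G_loc_continuous ::
  "space_kind \<Rightarrow> ((real ^ 'd \<Rightarrow> real) \<Rightarrow> real ^ 'd \<Rightarrow> real) \<Rightarrow> real \<Rightarrow> bool" where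
  "G_loc_continuous k G \<theta> \<longleftrightarrow>
     (\<forall>vs v. (\<forall>n. vs n \<in> E_plus k \<theta>) \<longrightarrow> v \<in> E_plus k \<theta> \<longrightarrow> loc_unif_conv k vs v \<longrightarrow>
        loc_unif_conv k (\<lambda>n. G (vs n)) (G v))"

definition G_shift_invariant ::
  "space_kind \<Rightarrow> ((real ^ 'd \<Rightarrow> real) \<Rightarrow> real ^ 'd \<Rightarrow> real) \<Rightarrow> real \<Rightarrow> bool" where
  "G_shift_invariant k G \<theta> \<longleftrightarrow>
     (\<forall>v \<in> E_plus k \<theta>. \<forall>y. eqE k (shift y (G v)) (G (shift y v)))"

definition G_const_less ::
  "space_kind \<Rightarrow> real \<Rightarrow> real \<Rightarrow> ((real ^ 'd \<Rightarrow> real) \<Rightarrow> real ^ 'd \<Rightarrow> real) \<Rightarrow> real \<Rightarrow> bool" where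
  "G_const_less k m \<kappa> G \<theta> \<longleftrightarrow>
     (\<forall>r. 0 < r \<and> r < \<theta> \<longrightarrow> holds_E k (\<lambda>x. G (\<lambda>_. r) x < \<kappa> - m))"

definition finite_first_moment :: "(real ^ 'd \<Rightarrow> real) \<Rightarrow> bool" where
  "finite_first_moment a \<longleftrightarrow> integrable lborel (\<lambda>y. norm y * a y)"

definition smooth_minorant ::
  "space_kind \<Rightarrow> (real ^ 'd \<Rightarrow> real) \<Rightarrow> real \<Rightarrow> ((real ^ 'd \<Rightarrow> real) \<Rightarrow> real ^ 'd \<Rightarrow> real)
     \<Rightarrow> real \<Rightarrow> bool" where
  "smooth_minorant k a \<kappa> G \<theta> \<longleftrightarrow>
     (\<exists>q\<ge>0. \<exists>\<delta>>0. \<exists>b. C_infinity b \<and> bounded (range b) \<and> (\<forall>x. 0 \<le> b x) \<and>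
        (AE x in lborel. a x - b x \<ge> \<delta> * indicator (ball 0 \<delta>) x) \<and>
        (\<forall>w \<in> E_plus k \<theta>.
           leE k (\<lambda>x. w x * G w x) (\<lambda>x. \<kappa> * conv b w x + q * w x)))"

definition basic_conditions ::
  "space_kind \<Rightarrow> real \<Rightarrow> (real ^ 'd \<Rightarrow> real) \<Rightarrow> real
     \<Rightarrow> ((real ^ 'd \<Rightarrow> real) \<Rightarrow> real ^ 'd \<Rightarrow> real) \<Rightarrow> real \<Rightarrow> bool" where
  "basic_conditions k m a \<kappa> G \<theta> \<longleftrightarrow>
     \<kappa> - m > 0 \<and> G_range k m \<kappa> G \<theta> \<and> G_lipschitz k G \<theta> \<and> quasi_monotone k a \<kappa> G \<theta>"

definition all_conditions ::
  "space_kind \<Rightarrow> real \<Rightarrow> (real ^ 'd \<Rightarrow> real) \<Rightarrow> real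
     \<Rightarrow> ((real ^ 'd \<Rightarrow> real) \<Rightarrow> real ^ 'd \<Rightarrow> real) \<Rightarrow> real \<Rightarrow> bool" where
  "all_conditions k m a \<kappa> G \<theta> \<longleftrightarrow>
     basic_conditions k m a \<kappa> G \<theta> \<and> positive_near_0 a \<and> G_loc_continuous k G \<theta> \<and>
     G_shift_invariant k G \<theta> \<and> G_const_less k m \<kappa> G \<theta> \<and> finite_first_moment a \<and>
     smooth_minorant k a \<kappa> G \<theta>"


section \<open>Classical solutions\<close>

text \<open>
  The time variable comes first: \<open>u t\<close> is the element \<open>u(\<cdot>,t)\<close> of \<open>E\<close>, and \<open>u'\<close> is the derivative
  of \<open>u\<close> in the norm of \<open>E\<close>.
\<close>

definition classical_solution ::
  "space_kind \<Rightarrow> real \<Rightarrow> (real ^ 'd \<Rightarrow> real) \<Rightarrow> real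
     \<Rightarrow> ((real ^ 'd \<Rightarrow> real) \<Rightarrow> real ^ 'd \<Rightarrow> real) \<Rightarrow> (real ^ 'd \<Rightarrow> real)
     \<Rightarrow> (real \<Rightarrow> real ^ 'd \<Rightarrow> real) \<Rightarrow> bool" where
  "classical_solution k m a \<kappa> G u0 u \<longleftrightarrow>
     (\<forall>t\<ge>0. u t \<in> space_E k) \<and>
     (\<forall>t\<ge>0. ((\<lambda>s. norm_E k (\<lambda>x. u s x - u t x)) \<longlongrightarrow> 0) (at t within {0..})) \<and>
     (\<exists>u'. (\<forall>t>0. u' t \<in> space_E k) \<and>
        (\<forall>t>0. ((\<lambda>s. norm_E k (\<lambda>x. (u s x - u t x) / (s - t) - u' t x)) \<longlongrightarrow> 0) (at t)) \<and>
        (\<forall>t>0. ((\<lambda>s. norm_E k (\<lambda>x. u' s x - u' t x)) \<longlongrightarrow> 0) (at t)) \<and>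
        (\<forall>t>0. eqE k (u' t)
           (\<lambda>x. \<kappa> * conv a (u t) x - m * u t x - u t x * G (u t) x))) \<and>
     eqE k (u 0) u0"

end

theory Submission
  imports Defs
begin

text \<open>
  Let \<open>b\<close>, \<open>\<kappa>'\<close>, \<open>G'\<close>, \<open>\<theta>'\<close> be the data with a fixed index \<open>n\<close>, and let \<open>c\<close> be their drift. It suffices to show
  that every level \<open>r < \<theta>'\<close> is eventually exceeded by \<open>u(\<cdot>, t)\<close> on each ball that moves with velocity
  \<open>c\<close> (\<open>solution_persists\<close>). The upper bound is \<open>u \<le> \<theta>\<close>, and the last assertion follows by letting
  \<open>n\<close> tend to infinity. Throughout, relations between elements of \<open>E\<close> are used almost
  everywhere; for continuous functions this is no loss.

  All information on the equation enters through a discrete form of the variation of constants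
  formula. By monotonicity, if \<open>v \<le> u(s)\<close> on a time interval \<open>t \<le> s \<le> t + h\<close>, then \<open>u\<close> grows on it at least at the
  rate that the data \<open>b\<close>, \<open>\<kappa>'\<close>, \<open>G'\<close> prescribe for \<open>v\<close> (\<open>solution_growing_flow\<close>, based on
  \<open>AE_increment_exp_lower_bound\<close>). Hence neither the existence of solutions of the approximating
  equation nor a comparison principle for it is needed; explicit functions \<open>v\<close> suffice.

  At small amplitude \<open>e\<close> the loss rate \<open>G' v\<close> is at most \<open>l e\<close>, as \<open>G'\<close> is Lipschitz with
  \<open>G' 0 = 0\<close>, so \<open>u\<close> stays above the steps of a supercritical linear equation (\<open>linear_step\<close>).
  Since \<open>b\<close> is bounded below near \<open>0\<close>, \<open>u\<close> is therefore positive on every ball after an arbitrarily short time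
  (\<open>positive_on_balls\<close>). A wide truncated paraboloid moving with velocity \<open>c\<close> is a strict
  subsolution of the linear equation: in the interior the supercritical growth dominates, because
  the velocity cancels the first moment of the kernel, and near the
  boundary the kink of the truncation dominates (\<open>conv_bump_lower_bound\<close>, \<open>bump_conv_step\<close>). So the
  amplitude of any wide paraboloid below \<open>u\<close> grows to a fixed value (\<open>bump_grows\<close>), which yields
  a positive persisting level (\<open>persists_positive_level\<close>).

  Finally let \<open>r0\<close> be the supremum of the persisting levels and suppose \<open>r0 < \<theta>'\<close>. As \<open>G' r0\<close> is a constant below \<open>\<kappa>' - m\<close>,
  and convolution and \<open>G'\<close> are continuous with respect to locally uniform convergence, any
  persisting level \<open>r\<close> close to \<open>r0\<close> can be raised by a factor independent of \<open>r\<close>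
  (\<open>persists_gain\<close>), a contradiction. Hence \<open>r0 = \<theta>'\<close>.
\<close>

section \<open>The spaces \<open>E\<close>\<close>

text \<open>
  Nonempty open sets are not null sets. This turns inequalities that hold almost everywhere
  into pointwise ones if \<open>E\<close> consists of continuous functions.
\<close>

lemma AE_nonneg_open_imp:
  fixes f :: "real ^ 'd \<Rightarrow> real"
  assumes "open S" "continuous_on UNIV f" "AE x in lborel. x \<in> S \<longrightarrow> 0 \<le> f x" "x \<in> S"
  shows "0 \<le> f x"
proof (rule ccontr)
  assume "\<not> 0 \<le> f x"
  let ?U = "S \<inter> {x. f x < 0}"
  have "open {x. f x < 0}"
    using assms(2) by (intro open_Collect_less) auto
  then have op: "open ?U" using assms(1) by auto
  have "AE x in lborel. x \<notin> ?U"
    using assms(3) by eventually_elim auto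
  then have "emeasure lborel ?U = 0"
    using op by (subst (asm) AE_iff_measurable[where N = ?U]) auto
  then have "?U \<in> null_sets lborel" using op by (auto simp: null_sets_def)
  then have "negligible ?U"
    by (simp add: negligible_iff_null_sets null_sets_completionI)
  then have "?U = {}" using op open_not_negligible by blast
  then show False using \<open>\<not> 0 \<le> f x\<close> \<open>x \<in> S\<close> by auto
qed

lemma holds_E_imp_AE: "holds_E k P \<Longrightarrow> AE x in lborel. P x"
  by (cases k) auto

lemma holds_E_I: "(\<And>x. P x) \<Longrightarrow> holds_E k P"
  by (cases k) auto

lemma leE_imp_AE: "leE k v w \<Longrightarrow> AE x in lborel. v x \<le> w x"
  unfolding leE_def by (rule holds_E_imp_AE)

lemma eqE_imp_AE: "eqE k v w \<Longrightarrow> AE x in lborel. v x = w x"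
  unfolding eqE_def by (rule holds_E_imp_AE)

lemma space_E_continuous: "v \<in> space_E k \<Longrightarrow> k \<noteq> Linf \<Longrightarrow> continuous_on UNIV v"
  by (cases k) (auto intro: uniformly_continuous_imp_continuous)

lemma space_E_measurable: "v \<in> space_E k \<Longrightarrow> v \<in> borel_measurable borel"
  by (cases k) (auto intro: borel_measurable_continuous_onI uniformly_continuous_imp_continuous)

lemma space_E_bounded:
  assumes "v \<in> space_E k" obtains C where "C \<ge> 0" "AE x in lborel. \<bar>v x\<bar> \<le> C"
proof -
  have "\<exists>C. AE x in lborel. \<bar>v x\<bar> \<le> C"
  proof (cases "k = Linf")
    case False
    then have "bounded (range v)" using assms by (cases k) auto
    then obtain C where "\<And>x. \<bar>v x\<bar> \<le> C" by (auto simp: bounded_iff)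
    then show ?thesis by auto
  qed (use assms in auto)
  then obtain C where "AE x in lborel. \<bar>v x\<bar> \<le> C" by auto
  then have "AE x in lborel. \<bar>v x\<bar> \<le> max 0 C" by eventually_elim auto
  then show ?thesis by (intro that[of "max 0 C"]) auto
qed

lemma leE_AE_I:
  assumes "v \<in> space_E k" "w \<in> space_E k" "AE x in lborel. v x \<le> w x"
  shows "leE k v w"
proof (cases "k = Linf")
  case False
  then have "continuous_on UNIV (\<lambda>x. w x - v x)"
    using assms by (intro continuous_intros space_E_continuous)
  then have "0 \<le> w x - v x" for x
    by (rule AE_nonneg_open_imp[where S = UNIV, rotated]) (use assms(3) in auto)
  then show ?thesis by (auto simp: leE_def intro!: holds_E_I)
qed (use assms in \<open>auto simp: leE_def\<close>)

lemma space_E_lin: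
  assumes "v \<in> space_E k" "w \<in> space_E k"
  shows "(\<lambda>x. c * v x + d * w x) \<in> space_E k"
proof -
  have *: "bounded (range (\<lambda>x. c * v x + d * w x))"
    if "bounded (range v)" "bounded (range w)"
  proof -
    have "bounded (range (\<lambda>x. c *\<^sub>R v x + d *\<^sub>R w x))"
      by (intro bounded_plus_comp bounded_scaleR_comp that)
    then show ?thesis by simp
  qed
  show ?thesis
  proof (cases k)
    case Linf
    obtain C D where "AE x in lborel. \<bar>v x\<bar> \<le> C" "AE x in lborel. \<bar>w x\<bar> \<le> D"
      using space_E_bounded assms by metis
    then have "AE x in lborel. \<bar>c * v x + d * w x\<bar> \<le> \<bar>c\<bar> * C + \<bar>d\<bar> * D"
    proof eventually_elim
      case (elim x)
      have "\<bar>c * v x + d * w x\<bar> \<le> \<bar>c\<bar> * \<bar>v x\<bar> + \<bar>d\<bar> * \<bar>w x\<bar>"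
        by (metis abs_mult abs_triangle_ineq)
      also have "\<dots> \<le> \<bar>c\<bar> * C + \<bar>d\<bar> * D"
        using elim by (intro add_mono mult_left_mono) auto
      finally show ?case .
    qed
    then show ?thesis using assms Linf by auto
  qed (use assms * in \<open>auto intro!: continuous_intros uniformly_continuous_on_cmul_left
          uniformly_continuous_on_add\<close>)
qed

lemma space_E_diff: "v \<in> space_E k \<Longrightarrow> w \<in> space_E k \<Longrightarrow> (\<lambda>x. v x - w x) \<in> space_E k"
  using space_E_lin[of v k w 1 "-1"] by simp

lemma uniformly_continuous_bounded_space_E:
  fixes f :: "real ^ 'd \<Rightarrow> real"
  assumes "uniformly_continuous_on UNIV f" "\<And>x. \<bar>f x\<bar> \<le> C"
  shows "f \<in> space_E k"
  using assms
  by (cases k) (auto simp: bounded_iff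
      intro: uniformly_continuous_imp_continuous borel_measurable_continuous_onI)

lemma lipschitz_bounded_space_E:
  fixes f :: "real ^ 'd \<Rightarrow> real"
  assumes "\<And>x y. \<bar>f x - f y\<bar> \<le> l * norm (x - y)" "\<And>x. \<bar>f x\<bar> \<le> C"
  shows "f \<in> space_E k"
proof (rule uniformly_continuous_bounded_space_E)
  show "uniformly_continuous_on UNIV f"
  unfolding uniformly_continuous_on_def
  proof safe
    fix e :: real assume "e > 0"
    show "\<exists>d>0. \<forall>x\<in>UNIV. \<forall>x'\<in>UNIV. dist x' x < d \<longrightarrow> dist (f x') (f x) < e"
    proof (intro exI[of _ "e / (\<bar>l\<bar> + 1)"] conjI ballI impI)
      fix x y :: "real ^ 'd" assume "dist y x < e / (\<bar>l\<bar> + 1)"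
      then have "(\<bar>l\<bar> + 1) * norm (y - x) < e"
        by (simp add: dist_norm field_simps)
      moreover have "l * norm (y - x) \<le> (\<bar>l\<bar> + 1) * norm (y - x)"
        by (intro mult_right_mono) auto
      ultimately show "dist (f y) (f x) < e"
        using assms(1)[of y x] by (simp add: dist_real_def)
    qed (use \<open>e > 0\<close> in auto)
  qed
qed (fact assms(2))

lemma E_plus_I:
  assumes "v \<in> space_E k" "\<And>x. 0 \<le> v x" "\<And>x. v x \<le> r"
  shows "v \<in> E_plus k r"
  using assms by (auto simp: E_plus_def leE_def intro: holds_E_I)

lemma E_plus_mono:
  assumes "v \<in> E_plus k r" "r \<le> s" shows "v \<in> E_plus k s"
proof -
  have "holds_E k (\<lambda>x. v x \<le> r) \<Longrightarrow> holds_E k (\<lambda>x. v x \<le> s)"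
    using assms(2) by (cases k) (auto elim!: eventually_mono intro: order.trans)
  then show ?thesis using assms(1) by (simp add: E_plus_def leE_def)
qed

lemma norm_E_bound:
  assumes "v \<in> space_E k" shows "AE x in lborel. \<bar>v x\<bar> \<le> norm_E k v"
proof (cases "k = Linf")
  case True
  obtain C where C: "C \<ge> 0" "AE x in lborel. \<bar>v x\<bar> \<le> C" using space_E_bounded[OF assms] .
  have [measurable]: "v \<in> borel_measurable borel" by (rule space_E_measurable[OF assms])
  let ?e = "esssup lborel (\<lambda>x. ereal \<bar>v x\<bar>)"
  have "?e \<le> ereal C" by (rule esssup_I) (use C in auto)
  then have "?e \<noteq> \<infinity>" by auto
  have "AE x in lborel. ereal \<bar>v x\<bar> \<le> ?e" by (rule esssup_AE)
  then show ?thesis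
  proof eventually_elim
    case (elim x)
    then have "?e \<noteq> -\<infinity>" by auto
    then show ?case using elim \<open>?e \<noteq> \<infinity>\<close> True by (cases ?e) auto
  qed
next
  case False
  then have "bounded (range v)" using assms by (cases k) auto
  then obtain C where C: "\<And>x. \<bar>v x\<bar> \<le> C" by (auto simp: bounded_iff)
  have "\<bar>v x\<bar> \<le> (SUP x. \<bar>v x\<bar>)" for x
    by (intro cSUP_upper bdd_aboveI[of _ C]) (use C in auto)
  then show ?thesis using False by (cases k) auto
qed

lemma norm_E_le:
  assumes "v \<in> space_E k" "\<And>x. \<bar>v x\<bar> \<le> C"
  shows "norm_E k v \<le> C"
proof (cases "k = Linf")
  case True
  have [measurable]: "v \<in> borel_measurable borel" by (rule space_E_measurable[OF assms(1)])
  have C: "C \<ge> 0" using assms(2)[of undefined] by auto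
  have "esssup lborel (\<lambda>x. ereal \<bar>v x\<bar>) \<le> ereal C" by (rule esssup_I) (use assms(2) in auto)
  then show ?thesis using True C by (cases "esssup lborel (\<lambda>x. ereal \<bar>v x\<bar>)") auto
next
  case False
  have "(SUP x. \<bar>v x\<bar>) \<le> C" by (rule cSUP_least) (use assms(2) in auto)
  then show ?thesis using False by (cases k) auto
qed

section \<open>Translations and convolutions\<close>

lemma lborel_translation_reflection:
  fixes z :: "real ^ 'd"
  assumes "c = 1 \<or> c = -1"
  shows "distr lborel borel (\<lambda>x. z + c *\<^sub>R x) = (lborel :: (real ^ 'd) measure)"
  using assms lborel_affine[of c z] by (auto simp: density_1)

lemma AE_translate_reflect:
  fixes z :: "real ^ 'd"
  assumes "c = 1 \<or> c = -1" "AE x in lborel. P x"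
  shows "AE x in lborel. P (z + c *\<^sub>R x)"
proof -
  from assms(2) obtain N where N: "N \<in> null_sets lborel" "{x. \<not> P x} \<subseteq> N"
    by (auto elim!: AE_E simp: null_sets_def)
  have "AE x in distr lborel borel (\<lambda>x. z + c *\<^sub>R x). x \<notin> N"
    unfolding lborel_translation_reflection[OF assms(1)] using N by (intro AE_not_in)
  then have "AE x in lborel. z + c *\<^sub>R x \<notin> N"
    using N by (subst (asm) AE_distr_iff) (auto simp: null_sets_def)
  then show ?thesis by eventually_elim (use N(2) in auto)
qed

lemma AE_translate: "AE x in lborel. P x \<Longrightarrow> AE x in lborel. P (x - z)" for z :: "real ^ 'd"
  using AE_translate_reflect[of 1 P "- z"] by simp

lemma AE_reflect: "AE x in lborel. P x \<Longrightarrow> AE x in lborel. P (z - x)" for z :: "real ^ 'd"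
  using AE_translate_reflect[of "- 1" P z] by simp

text \<open>
  By Fubini's theorem there is a point \<open>x\<close> with \<open>f (x - y) = f x\<close> for almost every \<open>y\<close>.
\<close>

lemma translation_invariant_AE_const:
  fixes f :: "real ^ 'd \<Rightarrow> real"
  assumes [measurable]: "f \<in> borel_measurable borel"
    and inv: "\<And>y. AE x in lborel. f (x - y) = f x"
  shows "\<exists>c. AE x in lborel. f x = c"
proof -
  have "AE y in lborel. AE x in lborel. f (x - y) = f x" using inv by simp
  moreover have "{z \<in> space (lborel \<Otimes>\<^sub>M lborel). f (fst z - snd z) = f (fst z)}
      \<in> sets (lborel \<Otimes>\<^sub>M lborel)" by measurable
  ultimately have "AE x in lborel. AE y in lborel. f (x - y) = f x"
    using lborel_pair.AE_commute[of "\<lambda>x y. f (x - y) = f x"] by blast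
  then obtain x where "AE y in lborel. f (x - y) = f x"
    using eventually_happens[of _ "ae_filter (lborel :: (real ^ 'd) measure)"]
    by (auto simp: ae_filter_eq_bot_iff)
  from AE_reflect[OF this, of x] show ?thesis by auto
qed

lemma lborel_integral_reflect:
  fixes f :: "real ^ 'd \<Rightarrow> real"
  assumes "f \<in> borel_measurable borel"
  shows "(LINT y|lborel. f (z - y)) = (LINT y|lborel. f y)"
proof -
  note * = lborel_translation_reflection[of "-1" z, simplified]
  show ?thesis
    by (subst (2) *[symmetric], subst integral_distr) (use assms in auto)
qed

lemma conv_commute:
  fixes b v :: "real ^ 'd \<Rightarrow> real"
  assumes [measurable]: "b \<in> borel_measurable borel" "v \<in> borel_measurable borel"
  shows "conv b v x = (LINT y|lborel. b y * v (x - y))"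
  unfolding conv_def
  using lborel_integral_reflect[of "\<lambda>y. b y * v (x - y)" x] by simp

lemma conv_cmult: "conv b (\<lambda>x. c * v x) x = c * conv b v x"
proof -
  have "(\<lambda>y. b (x - y) * (c * v y)) = (\<lambda>y. c * (b (x - y) * v y))" by (simp add: fun_eq_iff)
  then show ?thesis by (simp add: conv_def)
qed

lemma conv_shift:
  fixes b v :: "real ^ 'd \<Rightarrow> real"
  assumes [measurable]: "b \<in> borel_measurable borel" "v \<in> borel_measurable borel"
  shows "conv b (shift z v) x = conv b v (x - z)"
proof -
  have "shift z v \<in> borel_measurable borel" unfolding shift_def by measurable
  then show ?thesis by (simp add: conv_commute) (simp add: shift_def algebra_simps)
qed

lemma integrable_kernel_mult:
  fixes b v :: "real ^ 'd \<Rightarrow> real"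
  assumes "integrable lborel b" "v \<in> borel_measurable borel" "\<And>x. \<bar>v x\<bar> \<le> C"
  shows "integrable lborel (\<lambda>y. b y * v (x - y))"
proof (rule Bochner_Integration.integrable_bound)
  show "integrable lborel (\<lambda>y. C * b y)" using assms(1) by simp
  have [measurable]: "b \<in> borel_measurable borel" "v \<in> borel_measurable borel"
    using assms(1,2) by (auto dest: borel_measurable_integrable)
  show "(\<lambda>y. b y * v (x - y)) \<in> borel_measurable lborel" by measurable
  have "\<bar>b y\<bar> * \<bar>v (x - y)\<bar> \<le> \<bar>b y\<bar> * \<bar>C\<bar>" for y
    using assms(3)[of "x - y"] by (intro mult_left_mono) auto
  then show "AE y in lborel. norm (b y * v (x - y)) \<le> norm (C * b y)"
    by (simp add: abs_mult mult.commute)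
qed

section \<open>A lower bound for the growth of solutions\<close>

text \<open>
  A mean value inequality for curves in a space of functions modulo null sets. It cannot be
  obtained pointwise, since the exceptional null set of each differential quotient depends on the
  times involved; the bisection principle \<open>Bolzano\<close> uses only finitely many times.
\<close>

lemma AE_increment_lower_bound:
  fixes y y' :: "real \<Rightarrow> 'a \<Rightarrow> real" and g :: "'a \<Rightarrow> real"
  assumes "t1 \<le> t2"
    and der: "\<And>s e. t1 \<le> s \<Longrightarrow> s \<le> t2 \<Longrightarrow> e > 0 \<Longrightarrow>
      \<exists>d>0. \<forall>r. \<bar>r - s\<bar> < d \<longrightarrow> (AE x in M. \<bar>y r x - y s x - (r - s) * y' s x\<bar> \<le> e * \<bar>r - s\<bar>)"
    and low: "\<And>s. t1 \<le> s \<Longrightarrow> s \<le> t2 \<Longrightarrow> AE x in M. x \<in> S \<longrightarrow> y' s x \<ge> g x"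
  shows "AE x in M. x \<in> S \<longrightarrow> y t2 x - y t1 x \<ge> (t2 - t1) * g x"
proof -
  have approx: "AE x in M. x \<in> S \<longrightarrow> y t2 x - y t1 x \<ge> (t2 - t1) * (g x - e)" if epos: "e > 0" for e
    using \<open>t1 \<le> t2\<close>
  proof (induction rule: Bolzano)
    case (trans a b c)
    from trans(1,2) show ?case
      by eventually_elim (auto simp: algebra_simps)
  next
    case (local s)
    obtain d where d: "d > 0"
      "\<And>r. \<bar>r - s\<bar> < d \<Longrightarrow> AE x in M. \<bar>y r x - y s x - (r - s) * y' s x\<bar> \<le> e * \<bar>r - s\<bar>"
      using der[OF local epos] by blast
    show ?case
    proof (intro exI[of _ d] conjI allI impI \<open>d > 0\<close>)
      fix a b assume ab: "a \<le> s \<and> s \<le> b \<and> b - a < d"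
      then have "\<bar>a - s\<bar> < d" "\<bar>b - s\<bar> < d" by auto
      from d(2)[OF this(1)] d(2)[OF this(2)] low[OF local]
      show "AE x in M. x \<in> S \<longrightarrow> y b x - y a x \<ge> (b - a) * (g x - e)"
      proof eventually_elim
        case (elim x)
        show ?case
        proof
          assume "x \<in> S"
          then have g: "y' s x \<ge> g x" using elim by auto
          have "y b x - y s x \<ge> (b - s) * (y' s x - e)"
            using elim(2) ab by (auto simp: abs_le_iff algebra_simps)
          moreover have "y s x - y a x \<ge> (s - a) * (y' s x - e)"
            using elim(1) ab by (auto simp: abs_le_iff algebra_simps)
          ultimately have "y b x - y a x \<ge> (b - a) * (y' s x - e)"
            by (simp add: algebra_simps)
          moreover have "(b - a) * (y' s x - e) \<ge> (b - a) * (g x - e)"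
            using ab g by (intro mult_left_mono) auto
          ultimately show "y b x - y a x \<ge> (b - a) * (g x - e)" by linarith
        qed
      qed
    qed
  qed
  have "AE x in M. \<forall>n. x \<in> S \<longrightarrow> y t2 x - y t1 x \<ge> (t2 - t1) * (g x - 1 / real (Suc n))"
    unfolding AE_all_countable by (intro allI approx) simp
  then show ?thesis
  proof eventually_elim
    case (elim x)
    show ?case
    proof
      assume "x \<in> S"
      have "(\<lambda>n. (t2 - t1) * (g x - 1 / real (Suc n))) \<longlonglongrightarrow> (t2 - t1) * (g x - 0)"
        by (intro tendsto_intros LIMSEQ_Suc[OF lim_1_over_n])
      then show "y t2 x - y t1 x \<ge> (t2 - t1) * g x"
        using elim \<open>x \<in> S\<close> by (intro LIMSEQ_le_const2[where X = "\<lambda>n. (t2 - t1) * (g x - 1 / real (Suc n))"]) auto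
    qed
  qed
qed

text \<open>
  The integrating factor \<open>exp (\<mu> s)\<close> turns a lower bound for \<open>u' + \<mu> u\<close> on a time
  interval into a lower bound for the increment of \<open>u\<close>.
\<close>

lemma AE_increment_exp_lower_bound:
  fixes u u' :: "real \<Rightarrow> 'a \<Rightarrow> real" and g :: "'a \<Rightarrow> real"
  assumes "0 \<le> h"
    and der: "\<And>s e. t \<le> s \<Longrightarrow> s \<le> t + h \<Longrightarrow> e > 0 \<Longrightarrow>
      \<exists>d>0. \<forall>r. \<bar>r - s\<bar> < d \<longrightarrow> (AE x in M. \<bar>u r x - u s x - (r - s) * u' s x\<bar> \<le> e * \<bar>r - s\<bar>)"
    and bdd: "\<And>s. t \<le> s \<Longrightarrow> s \<le> t + h \<Longrightarrow> \<exists>C. AE x in M. \<bar>u s x\<bar> \<le> C \<and> \<bar>u' s x\<bar> \<le> C"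
    and low: "\<And>s. t \<le> s \<Longrightarrow> s \<le> t + h \<Longrightarrow>
      AE x in M. x \<in> S \<longrightarrow> u' s x + \<mu> * u s x \<ge> exp (- \<mu> * (s - t)) * g x"
  shows "AE x in M. x \<in> S \<longrightarrow> u (t + h) x \<ge> exp (- \<mu> * h) * (u t x + h * g x)"
proof -
  define E where "E s = exp (\<mu> * (s - t))" for s
  have E: "E s > 0" "exp (- \<mu> * (s - t)) = 1 / E s" for s
    by (simp_all add: E_def inverse_eq_divide[symmetric] exp_minus[symmetric])
  have "AE x in M. x \<in> S \<longrightarrow>
     E (t + h) * u (t + h) x - E t * u t x \<ge> (t + h - t) * g x"
  proof (rule AE_increment_lower_bound[where y = "\<lambda>s x. E s * u s x"
        and y' = "\<lambda>s x. E s * (u' s x + \<mu> * u s x)"])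
    fix s assume s: "t \<le> s" "s \<le> t + h"
    show "AE x in M. x \<in> S \<longrightarrow> E s * (u' s x + \<mu> * u s x) \<ge> g x"
      using low[OF s, unfolded E(2)] by eventually_elim (use E(1)[of s] in \<open>simp add: field_simps\<close>)
  next
    fix s e :: real assume s: "t \<le> s" "s \<le> t + h" and e: "e > 0"
    obtain C where C: "AE x in M. \<bar>u s x\<bar> \<le> C \<and> \<bar>u' s x\<bar> \<le> C" using bdd[OF s] by auto
    define B where "B = max C 0 + 1"
    have B: "B \<ge> 1" "C \<le> B" by (auto simp: B_def)
    define F where "F = E s + 1"
    have F: "F > 1" using E(1)[of s] by (simp add: F_def)
    have "isCont E s" unfolding E_def by (intro continuous_intros)
    define e1 where "e1 = min 1 (e / (3 * B))"
    have e1: "0 < e1" "e1 \<le> 1" "e1 * B \<le> e / 3"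
    proof -
      show "0 < e1" "e1 \<le> 1" using e B by (auto simp: e1_def)
      have "e1 * B \<le> e / (3 * B) * B" using B by (intro mult_right_mono) (auto simp: e1_def)
      then show "e1 * B \<le> e / 3" using B by simp
    qed
    obtain d1 where d1: "d1 > 0" "\<And>r. \<bar>r - s\<bar> < d1 \<Longrightarrow> \<bar>E r - E s\<bar> < e1"
      using LIM_D[OF \<open>isCont E s\<close>[unfolded isCont_def] e1(1)] by (metis abs_zero diff_self e1(1) real_norm_def)
    have "(E has_real_derivative \<mu> * E s) (at s)"
      unfolding E_def by (auto intro!: derivative_eq_intros)
    then have "((\<lambda>r. (E r - E s) / (r - s)) \<longlongrightarrow> \<mu> * E s) (at s)"
      by (simp add: has_field_derivative_iff)
    from LIM_D[OF this e1(1)] obtain d2 where d2: "d2 > 0"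
      "\<And>r. r \<noteq> s \<Longrightarrow> \<bar>r - s\<bar> < d2 \<Longrightarrow> \<bar>(E r - E s) / (r - s) - \<mu> * E s\<bar> < e1"
      by (auto simp: real_norm_def)
    have d2': "\<bar>E r - E s - (r - s) * (\<mu> * E s)\<bar> \<le> e1 * \<bar>r - s\<bar>" if "\<bar>r - s\<bar> < d2" for r
    proof (cases "r = s")
      case False
      have "E r - E s - (r - s) * (\<mu> * E s) = ((E r - E s) / (r - s) - \<mu> * E s) * (r - s)"
        using False by (simp add: field_simps)
      then have "\<bar>E r - E s - (r - s) * (\<mu> * E s)\<bar>
          = \<bar>(E r - E s) / (r - s) - \<mu> * E s\<bar> * \<bar>r - s\<bar>" by (simp add: abs_mult)
      also have "\<dots> \<le> e1 * \<bar>r - s\<bar>"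
        using d2(2)[OF False that] by (intro mult_right_mono) auto
      finally show ?thesis .
    qed simp
    have "e / (3 * F) > 0" using e F by simp
    from der[OF s this] obtain d3 where d3: "d3 > 0"
      "\<And>r. \<bar>r - s\<bar> < d3 \<Longrightarrow>
         AE x in M. \<bar>u r x - u s x - (r - s) * u' s x\<bar> \<le> e / (3 * F) * \<bar>r - s\<bar>" by blast
    show "\<exists>d>0. \<forall>r. \<bar>r - s\<bar> < d \<longrightarrow> (AE x in M.
      \<bar>E r * u r x - E s * u s x - (r - s) * (E s * (u' s x + \<mu> * u s x))\<bar> \<le> e * \<bar>r - s\<bar>)"
    proof (intro exI[of _ "min d1 (min d2 d3)"] conjI allI impI)
      fix r assume r: "\<bar>r - s\<bar> < min d1 (min d2 d3)"
      have Er: "\<bar>E r\<bar> \<le> F" using d1(2)[of r] r e1 E(1)[of r] by (simp add: F_def)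
      from d3(2)[of r] have "AE x in M. \<bar>u r x - u s x - (r - s) * u' s x\<bar> \<le> e / (3 * F) * \<bar>r - s\<bar>"
        using r by auto
      with C show "AE x in M. \<bar>E r * u r x - E s * u s x - (r - s) * (E s * (u' s x + \<mu> * u s x))\<bar>
           \<le> e * \<bar>r - s\<bar>"
      proof eventually_elim
        case (elim x)
        have "E r * u r x - E s * u s x - (r - s) * (E s * (u' s x + \<mu> * u s x))
          = E r * (u r x - u s x - (r - s) * u' s x) + (E r - E s) * ((r - s) * u' s x)
            + (E r - E s - (r - s) * (\<mu> * E s)) * u s x" by (simp add: algebra_simps)
        also have "\<bar>\<dots>\<bar> \<le> \<bar>E r * (u r x - u s x - (r - s) * u' s x)\<bar>
            + \<bar>(E r - E s) * ((r - s) * u' s x)\<bar> + \<bar>(E r - E s - (r - s) * (\<mu> * E s)) * u s x\<bar>"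
          by linarith
        also have "\<bar>E r * (u r x - u s x - (r - s) * u' s x)\<bar> \<le> F * (e / (3 * F) * \<bar>r - s\<bar>)"
          unfolding abs_mult using Er elim F by (intro mult_mono) auto
        also have "F * (e / (3 * F) * \<bar>r - s\<bar>) = e / 3 * \<bar>r - s\<bar>" using F by simp
        also have "\<bar>(E r - E s) * ((r - s) * u' s x)\<bar> \<le> e1 * (\<bar>r - s\<bar> * B)"
          unfolding abs_mult using d1(2)[of r] r elim B e1 by (intro mult_mono) auto
        also have "\<dots> \<le> e / 3 * \<bar>r - s\<bar>"
          using mult_right_mono[OF e1(3), of "\<bar>r - s\<bar>"] by (simp add: mult_ac)
        also have "\<bar>(E r - E s - (r - s) * (\<mu> * E s)) * u s x\<bar> \<le> (e1 * \<bar>r - s\<bar>) * B"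
          unfolding abs_mult using d2'[of r] r elim B e1 by (intro mult_mono) auto
        also have "\<dots> \<le> e / 3 * \<bar>r - s\<bar>"
          using mult_right_mono[OF e1(3), of "\<bar>r - s\<bar>"] by (simp add: mult_ac)
        finally show ?case by simp
      qed
    qed (use d1 d2 d3 in auto)
  qed (use assms(1) in auto)
  then show ?thesis
  proof eventually_elim
    case (elim x)
    show ?case
    proof
      assume "x \<in> S"
      then have "u t x + h * g x \<le> E (t + h) * u (t + h) x" using elim by (simp add: E_def)
      then have "exp (- \<mu> * h) * (u t x + h * g x) \<le> exp (- \<mu> * h) * (E (t + h) * u (t + h) x)"
        by (intro mult_left_mono) auto
      also have "\<dots> = u (t + h) x"
        by (simp add: E_def mult.assoc[symmetric] exp_add[symmetric])
      finally show "u (t + h) x \<ge> exp (- \<mu> * h) * (u t x + h * g x)" .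
    qed
  qed
qed

text \<open>The equation of a classical solution, in terms of differential quotients almost everywhere.\<close>

lemma classical_solution_AE_derivative:
  fixes u :: "real \<Rightarrow> real ^ 'd \<Rightarrow> real"
  assumes "classical_solution k m a \<kappa> G u0 u"
  obtains u' where "\<And>t. t > 0 \<Longrightarrow> u' t \<in> space_E k"
    and "\<And>t e. t > 0 \<Longrightarrow> e > 0 \<Longrightarrow> \<exists>d>0. \<forall>s. \<bar>s - t\<bar> < d \<longrightarrow>
           (AE x in lborel. \<bar>u s x - u t x - (s - t) * u' t x\<bar> \<le> e * \<bar>s - t\<bar>)"
    and "\<And>t. t > 0 \<Longrightarrow> AE x in lborel. u' t x = reaction a \<kappa> G (u t) x - m * u t x"
proof -
  from assms obtain u' where E: "\<And>t. t \<ge> 0 \<Longrightarrow> u t \<in> space_E k"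
    and u': "\<And>t. t > 0 \<Longrightarrow> u' t \<in> space_E k"
    and der: "\<And>t. t > 0 \<Longrightarrow>
        ((\<lambda>s. norm_E k (\<lambda>x. (u s x - u t x) / (s - t) - u' t x)) \<longlongrightarrow> 0) (at t)"
    and eq: "\<And>t. t > 0 \<Longrightarrow>
        eqE k (u' t) (\<lambda>x. \<kappa> * conv a (u t) x - m * u t x - u t x * G (u t) x)"
    unfolding classical_solution_def by blast
  show ?thesis
  proof (rule that[of u', OF u'])
    fix t :: real assume "t > 0"
    show "AE x in lborel. u' t x = reaction a \<kappa> G (u t) x - m * u t x"
      using eqE_imp_AE[OF eq[OF \<open>t > 0\<close>]] by eventually_elim (simp add: reaction_def)
  next
    fix t e :: real assume "t > 0" "e > 0"
    from LIM_D[OF der[OF \<open>t > 0\<close>] \<open>e > 0\<close>] obtain d where d: "d > 0"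
      "\<And>s. s \<noteq> t \<Longrightarrow> \<bar>s - t\<bar> < d \<Longrightarrow> \<bar>norm_E k (\<lambda>x. (u s x - u t x) / (s - t) - u' t x)\<bar> < e"
      by auto
    show "\<exists>d>0. \<forall>s. \<bar>s - t\<bar> < d \<longrightarrow>
           (AE x in lborel. \<bar>u s x - u t x - (s - t) * u' t x\<bar> \<le> e * \<bar>s - t\<bar>)"
    proof (intro exI[of _ "min d t"] conjI allI impI)
      fix s assume s: "\<bar>s - t\<bar> < min d t"
      show "AE x in lborel. \<bar>u s x - u t x - (s - t) * u' t x\<bar> \<le> e * \<bar>s - t\<bar>"
      proof (cases "s = t")
        case False
        let ?q = "\<lambda>x. (u s x - u t x) / (s - t) - u' t x"
        have "s > 0" using s by auto
        have "(\<lambda>x. 1 / (s - t) * (u s x - u t x) + (-1) * u' t x) \<in> space_E k"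
          using E \<open>s > 0\<close> \<open>t > 0\<close> u' by (intro space_E_lin space_E_diff) auto
        then have "?q \<in> space_E k" by simp
        from norm_E_bound[OF this] show ?thesis
        proof eventually_elim
          case (elim x)
          have "\<bar>?q x\<bar> \<le> e" using elim d(2)[OF False] s by auto
          then have "\<bar>?q x\<bar> * \<bar>s - t\<bar> \<le> e * \<bar>s - t\<bar>" by (intro mult_right_mono) auto
          moreover have "?q x * (s - t) = u s x - u t x - (s - t) * u' t x"
            using False by (simp add: field_simps)
          ultimately show ?case by (metis abs_mult)
        qed
      qed simp
    qed (use d \<open>t > 0\<close> in auto)
  qed
qed

section \<open>Paraboloid bumps\<close>

text \<open>
  The paraboloid of height \<open>1\<close> and radius \<open>L\<close> centred at \<open>z\<close>, truncated at \<open>0\<close>. It is Lipschitz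
  with bounded support, hence in every space \<open>E\<close>, and has a kink on the boundary of its support.
\<close>

definition bump :: "real \<Rightarrow> real ^ 'd \<Rightarrow> real ^ 'd \<Rightarrow> real" where
  "bump L z x = max 0 (1 - (norm (x - z) / L)\<^sup>2)"

lemma bump_nonneg [simp]: "0 \<le> bump L z x"
  and bump_le_1 [simp]: "bump L z x \<le> 1"
  by (simp_all add: bump_def)

lemma abs_bump_le_1 [simp]: "\<bar>bump L z x\<bar> \<le> 1"
  by (simp add: abs_of_nonneg)

lemma bump_eq_0: "L > 0 \<Longrightarrow> norm (x - z) \<ge> L \<Longrightarrow> bump L z x = 0"
  by (simp add: bump_def)

lemma bump_shift: "bump L z = shift z (bump L 0)"
  by (simp add: fun_eq_iff bump_def shift_def)

lemma bump_lipschitz: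
  assumes "L > 0"
  shows "\<bar>bump L z x - bump L z y\<bar> \<le> 2 / L * norm (x - y)"
proof -
  define P where "P w = min (norm (w - z) / L) 1" for w
  have P: "bump L z w = 1 - (P w)\<^sup>2" "0 \<le> P w" "P w \<le> 1" for w
  proof -
    define a where "a = norm (w - z) / L"
    have "0 \<le> a" using assms by (simp add: a_def)
    show "0 \<le> P w" "P w \<le> 1" using \<open>0 \<le> a\<close> by (simp_all add: P_def a_def[symmetric])
    show "bump L z w = 1 - (P w)\<^sup>2"
    proof (cases "a \<le> 1")
      case True
      then have "a\<^sup>2 \<le> 1" using \<open>0 \<le> a\<close> by (simp add: power_le_one)
      then show ?thesis using True by (simp add: bump_def P_def a_def[symmetric])
    next
      case False
      then have "1 \<le> a\<^sup>2" by simp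
      then show ?thesis using False by (simp add: bump_def P_def a_def[symmetric])
    qed
  qed
  have "bump L z x - bump L z y = (P y - P x) * (P y + P x)"
    by (simp add: P(1) power2_eq_square algebra_simps)
  then have "\<bar>bump L z x - bump L z y\<bar> = \<bar>P y - P x\<bar> * (P y + P x)"
    using P(2) by (simp add: abs_mult)
  also have "\<dots> \<le> (norm (x - y) / L) * 2"
  proof (intro mult_mono)
    have "\<bar>norm (y - z) - norm (x - z)\<bar> \<le> norm (x - y)"
      using norm_triangle_ineq3[of "y - z" "x - z"] by (simp add: norm_minus_commute)
    then have "\<bar>norm (y - z) / L - norm (x - z) / L\<bar> \<le> norm (x - y) / L"
      using assms by (simp add: diff_divide_distrib[symmetric] divide_right_mono)
    then show "\<bar>P y - P x\<bar> \<le> norm (x - y) / L" 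
      unfolding P_def min_def by (auto simp: abs_le_iff)
    show "P y + P x \<le> 2" using P(3)[of x] P(3)[of y] by linarith
  qed (use P assms in auto)
  finally show ?thesis by (simp add: mult.commute)
qed

lemma bump_space_E:
  assumes "L > 0" shows "(\<lambda>x. c * bump L z x) \<in> space_E k"
proof -
  have "bump L z \<in> space_E k"
    by (rule lipschitz_bounded_space_E[OF bump_lipschitz[OF assms], where C = 1]) simp
  from space_E_lin[OF this this, of c 0] show ?thesis by simp
qed

lemma bump_E_plus: "L > 0 \<Longrightarrow> 0 \<le> A \<Longrightarrow> A \<le> r \<Longrightarrow> (\<lambda>x. A * bump L z x) \<in> E_plus k r"
  by (rule E_plus_I) (auto intro: bump_space_E order.trans[OF mult_left_le])

lemma bump_measurable [measurable]: "bump L z \<in> borel_measurable borel"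
  unfolding bump_def by measurable

lemma measure_ball_translate: "measure lborel (ball (q :: real ^ 'd) r) = measure lborel (ball (0 :: real ^ 'd) r)"
proof (cases "r \<ge> 0")
  case True
  show ?thesis by (simp only: content_ball[OF True])
next
  case False
  then have "ball q r = {}" "ball (0 :: real ^ 'd) r = {}" by auto
  then show ?thesis by metis
qed

text \<open>
  The kernel is bounded below near the origin, so the convolution exceeds a fixed multiple of any
  lower bound of the function on a small ball near the point.
\<close>

lemma conv_lower_bound_ball:
  fixes b v :: "real ^ 'd \<Rightarrow> real"
  assumes b: "integrable lborel b" "AE y in lborel. 0 \<le> b y"
      "AE y in lborel. y \<in> ball 0 \<rho> \<longrightarrow> \<rho> \<le> b y"
    and v: "v \<in> borel_measurable borel" "\<And>y. 0 \<le> v y" "\<And>y. v y \<le> C"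
    and s: "0 \<le> s" "0 \<le> \<rho>" "\<And>y. y \<in> ball q r \<Longrightarrow> norm (x - y) < \<rho> \<and> s \<le> v y"
  shows "\<rho> * s * measure lborel (ball (0 :: real ^ 'd) r) \<le> conv b v x"
proof -
  have [measurable]: "b \<in> borel_measurable borel" "v \<in> borel_measurable borel"
    using b v by (auto dest: borel_measurable_integrable)
  let ?B = "ball (x - q) r"
  have "\<rho> * s * measure lborel (ball (0 :: real ^ 'd) r) = (LINT y|lborel. \<rho> * s * indicator ?B y)"
    by (simp add: measure_ball_translate[of "x - q"])
  also have "\<dots> \<le> (LINT y|lborel. b y * v (x - y))"
  proof (rule integral_mono_AE)
    show "integrable lborel (\<lambda>y. \<rho> * s * indicator ?B y)"
      by (intro integrable_mult_right integrable_real_indicator) (simp_all add: emeasure_lborel_ball_finite[unfolded infinity_ennreal_def])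
    show "integrable lborel (\<lambda>y. b y * v (x - y))"
      using v(2,3) by (intro integrable_kernel_mult[where C = C] b v(1)) simp
    show "AE y in lborel. \<rho> * s * indicator ?B y \<le> b y * v (x - y)"
      using b(2,3)
    proof eventually_elim
      case (elim y)
      show ?case
      proof (cases "y \<in> ?B")
        case True
        then have "x - y \<in> ball q r" by (simp add: dist_norm algebra_simps norm_minus_commute)
        from s(3)[OF this] have "norm y < \<rho>" "s \<le> v (x - y)" by auto
        then show ?thesis using True elim s by (auto intro!: mult_mono)
      qed (use elim v in auto)
    qed
  qed
  also have "\<dots> = conv b v x" by (simp add: conv_commute)
  finally show ?thesis .
qed

text \<open>
  No second moment of the kernel is assumed, so only \<open>|y| \<le> R\<close> is expanded to
  second order; the tail \<open>T\<close> of the first moment accounts for the rest.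
  At a point \<open>x\<close> near the boundary of its support the bump is small, while its values on the far
  side are cut off at \<open>0\<close> instead of being negative there. This gain \<open>K\<close> of order \<open>1 / L\<close> is what
  outweighs the second order terms and the tails of the kernel.
\<close>

lemma conv_bump_lower_bound:
  fixes b :: "real ^ 'd \<Rightarrow> real" and x :: "real ^ 'd"
  assumes b: "integrable lborel b" "AE y in lborel. 0 \<le> b y" "(LINT y|lborel. b y) = 1"
      "AE y in lborel. y \<in> ball 0 \<rho> \<longrightarrow> \<rho> \<le> b y"
    and moment: "integrable lborel (\<lambda>y. norm y * b y)"
    and R: "1 \<le> R" "0 < \<rho>" "\<rho> \<le> R"
    and L: "0 < L" "norm x \<le> 2 * L"
    and \<tau>: "\<tau> = 1 - (norm x / L)\<^sup>2"
    and K: "K = 0 \<or> K = \<rho> / (4 * L) \<and> L / 2 \<le> norm x \<and> \<tau> \<le> \<rho> / (8 * L)"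
    and T: "T = (LINT y|lborel. norm y * b y * indicator {y. R < norm y} y)"
  shows "conv b (bump L 0) x \<ge> \<tau> + 2 / L\<^sup>2 * (x \<bullet> (LINT y|lborel. b y *\<^sub>R y))
     - R / L\<^sup>2 * (LINT y|lborel. norm y * b y) - (\<bar>\<tau>\<bar> + 4 / L) * T
     + K * \<rho> * measure lborel (ball (0 :: real ^ 'd) (\<rho> / 8))"
proof -
  have [measurable]: "b \<in> borel_measurable borel"
    using b by (auto dest: borel_measurable_integrable)
  define q where "q = (- (\<rho> / (2 * norm x))) *\<^sub>R x"
  let ?B = "ball q (\<rho> / 8)"
  let ?far = "{y :: real ^ 'd. R < norm y}"
  define f where "f y = \<tau> + 2 / L\<^sup>2 * (x \<bullet> y) - R / L\<^sup>2 * norm y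
      - (\<bar>\<tau>\<bar> + 4 / L) * (norm y * indicator ?far y) + K * indicator ?B y" for y
  have K0: "0 \<le> K" using K R L by auto
  have normq: "norm q = \<rho> / 2" if "K \<noteq> 0"
    using K that L R by (auto simp: q_def)
  have near: "norm y < \<rho>" if "y \<in> ?B" "K \<noteq> 0" for y
  proof -
    have "norm y \<le> norm q + norm (y - q)" by (metis add.commute diff_add_cancel norm_triangle_ineq)
    then show ?thesis using that normq R by (auto simp: dist_norm norm_minus_commute)
  qed
  \<comment> \<open>\<open>f\<close> is the untruncated paraboloid seen from \<open>x\<close>, with \<open>|y|\<^sup>2\<close> replaced by \<open>R |y|\<close>, a correction
    where \<open>|y| > R\<close>, and the gain \<open>K\<close> where the paraboloid is negative\<close>
  have f_le: "f y \<le> bump L 0 (x - y)" for y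
  proof -
    have xy: "norm (x - y) ^ 2 = norm x ^ 2 - 2 * (x \<bullet> y) + norm y ^ 2"
      by (simp add: power2_norm_eq_inner inner_diff_left inner_diff_right inner_commute)
    have bump: "bump L 0 (x - y) = max 0 (\<tau> + 2 / L\<^sup>2 * (x \<bullet> y) - norm y ^ 2 / L\<^sup>2)"
      by (simp add: bump_def \<tau> power_divide xy add_divide_distrib diff_divide_distrib)
    show ?thesis
    proof (cases "R < norm y")
      case True
      have "K * indicator ?B y = 0" using near[of y] True R by (auto simp: indicator_def)
      moreover have "2 / L\<^sup>2 * (x \<bullet> y) \<le> 4 / L * norm y"
      proof -
        have "x \<bullet> y \<le> norm x * norm y" by (rule norm_cauchy_schwarz)
        also have "\<dots> \<le> 2 * L * norm y" using L by (intro mult_right_mono) auto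
        finally have "2 / L\<^sup>2 * (x \<bullet> y) \<le> 2 / L\<^sup>2 * (2 * L * norm y)"
          by (intro mult_left_mono) auto
        also have "\<dots> = 4 / L * norm y" using L by (simp add: power2_eq_square)
        finally show ?thesis .
      qed
      moreover have "\<tau> \<le> \<bar>\<tau>\<bar> * norm y"
        using mult_left_mono[of 1 "norm y" "\<bar>\<tau>\<bar>"] True R by auto
      moreover have "0 \<le> R / L\<^sup>2 * norm y" using R by auto
      moreover have "f y = \<tau> + 2 / L\<^sup>2 * (x \<bullet> y) - R / L\<^sup>2 * norm y
          - (\<bar>\<tau>\<bar> * norm y + 4 / L * norm y) + K * indicator ?B y"
        using True by (simp add: f_def distrib_right)
      ultimately have "f y \<le> 0" by linarith
      then show ?thesis by (rule order.trans) simp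
    next
      case False
      then have "norm y ^ 2 \<le> R * norm y"
        by (simp add: power2_eq_square mult_right_mono)
      then have sq: "norm y ^ 2 / L\<^sup>2 \<le> R / L\<^sup>2 * norm y"
        by (simp add: divide_right_mono)
      show ?thesis
      proof (cases "y \<in> ?B \<and> K \<noteq> 0")
        case True
        then have KK: "K = \<rho> / (4 * L)" "L / 2 \<le> norm x" "\<tau> \<le> \<rho> / (8 * L)" using K by auto
        have x0: "norm x > 0" using KK L by auto
        have "x \<bullet> q = - (\<rho> / 2) * norm x"
          using x0 by (simp add: q_def power2_norm_eq_inner[symmetric] power2_eq_square)
        moreover have "x \<bullet> (y - q) \<le> norm x * (\<rho> / 8)"
        proof -
          have "x \<bullet> (y - q) \<le> norm x * norm (y - q)" by (rule norm_cauchy_schwarz)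
          also have "\<dots> \<le> norm x * (\<rho> / 8)"
            using True by (intro mult_left_mono) (auto simp: dist_norm norm_minus_commute)
          finally show ?thesis .
        qed
        ultimately have "x \<bullet> y \<le> - (3 / 8 * \<rho>) * norm x"
          by (simp add: inner_diff_right algebra_simps)
        also have "\<dots> \<le> - (3 / 8 * \<rho>) * (L / 2)"
          using KK R by (intro mult_left_mono_neg) auto
        finally have "2 / L\<^sup>2 * (x \<bullet> y) \<le> 2 / L\<^sup>2 * (- (3 / 8 * \<rho>) * (L / 2))"
          by (intro mult_left_mono) auto
        also have "\<dots> = - (\<rho> / (4 * L)) - \<rho> / (8 * L)"
          using L by (simp add: power2_eq_square field_simps)
        finally have "2 / L\<^sup>2 * (x \<bullet> y) \<le> - (\<rho> / (4 * L)) - \<rho> / (8 * L)" .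
        moreover have "f y = \<tau> + 2 / L\<^sup>2 * (x \<bullet> y) - R / L\<^sup>2 * norm y + \<rho> / (4 * L)"
          using True False KK(1) by (simp add: f_def)
        moreover have "0 \<le> R / L\<^sup>2 * norm y" using R by auto
        ultimately have "f y \<le> 0" using KK(3) by linarith
        then show ?thesis by (rule order.trans) simp
      next
        case nB: False
        then have "K * indicator ?B y = 0" by (auto simp: indicator_def)
        moreover have "f y = \<tau> + 2 / L\<^sup>2 * (x \<bullet> y) - R / L\<^sup>2 * norm y + K * indicator ?B y"
          using False by (simp add: f_def)
        ultimately have "f y \<le> \<tau> + 2 / L\<^sup>2 * (x \<bullet> y) - norm y ^ 2 / L\<^sup>2"
          using sq by linarith
        then show ?thesis by (simp add: bump)
      qed
    qed
  qed
  have vec: "integrable lborel (\<lambda>y. b y *\<^sub>R y)"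
    by (rule Bochner_Integration.integrable_bound[OF moment])
       (auto simp: mult.commute)
  have far: "integrable lborel (\<lambda>y. norm y * b y * indicator ?far y)"
    by (rule integrable_real_mult_indicator[OF _ moment]) simp
  have ball: "integrable lborel (\<lambda>y. b y * indicator ?B y)"
    by (rule integrable_real_mult_indicator[OF _ b(1)]) simp
  have inner: "integrable lborel (\<lambda>y. x \<bullet> (b y *\<^sub>R y))"
    by (rule integrable_inner_right[OF vec])
  have bf: "(\<lambda>y. b y * f y) = (\<lambda>y. \<tau> * b y + 2 / L\<^sup>2 * (x \<bullet> (b y *\<^sub>R y)) - R / L\<^sup>2 * (norm y * b y)
      - (\<bar>\<tau>\<bar> + 4 / L) * (norm y * b y * indicator ?far y) + K * (b y * indicator ?B y))"
    by (simp add: f_def fun_eq_iff algebra_simps)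
  have intf: "integrable lborel (\<lambda>y. b y * f y)"
    unfolding bf by (intro Bochner_Integration.integrable_add Bochner_Integration.integrable_diff
        integrable_mult_right b(1) inner moment far ball)
  have int_bf: "(LINT y|lborel. b y * f y) = \<tau> * 1 + 2 / L\<^sup>2 * (x \<bullet> (LINT y|lborel. b y *\<^sub>R y))
      - R / L\<^sup>2 * (LINT y|lborel. norm y * b y) - (\<bar>\<tau>\<bar> + 4 / L) * T
      + K * (LINT y|lborel. b y * indicator ?B y)"
    unfolding bf T b(3)[symmetric] integral_inner_right[OF vec, symmetric]
    using b(1) inner moment far ball
    by (simp add: Bochner_Integration.integral_add Bochner_Integration.integral_diff
        del: inner_scaleR_right integrable_mult_left_iff integrable_mult_right_iff)
  have "K * \<rho> * measure lborel (ball (0 :: real ^ 'd) (\<rho> / 8)) \<le> K * (LINT y|lborel. b y * indicator ?B y)"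
  proof (cases "K = 0")
    case False
    have "\<rho> * measure lborel (ball (0 :: real ^ 'd) (\<rho> / 8)) = (LINT y|lborel. \<rho> * indicator ?B y)"
      by (simp add: measure_ball_translate[of q])
    also have "\<dots> \<le> (LINT y|lborel. b y * indicator ?B y)"
    proof (rule integral_mono_AE)
      show "integrable lborel (\<lambda>y. \<rho> * indicator ?B y)"
        by (intro integrable_mult_right integrable_real_indicator) (simp_all add: emeasure_lborel_ball_finite[unfolded infinity_ennreal_def])
      show "AE y in lborel. \<rho> * indicator ?B y \<le> b y * indicator ?B y"
        using b(4) by eventually_elim (use near False in \<open>auto simp: indicator_def\<close>)
    qed (fact ball)
    finally show ?thesis using K0 by (simp add: mult.assoc mult_left_mono)
  qed simp
  moreover have "(LINT y|lborel. b y * f y) \<le> (LINT y|lborel. b y * bump L 0 (x - y))"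
  proof (rule integral_mono_AE[OF intf])
    show "integrable lborel (\<lambda>y. b y * bump L 0 (x - y))"
      by (rule integrable_kernel_mult[OF b(1), where C = 1]) auto
    show "AE y in lborel. b y * f y \<le> b y * bump L 0 (x - y)"
      using b(2) by eventually_elim (rule mult_left_mono[OF f_le])
  qed
  ultimately show ?thesis
    using int_bf by (simp add: conv_commute)
qed

section \<open>Growth from small amplitudes\<close>

text \<open>
  The properties of the solution that persistence rests on. The function \<open>u\<close> need not solve the
  equation with data \<open>b\<close>, \<open>\<kappa>\<close>, \<open>G\<close>: by \<open>growth\<close> it only has to grow at least as that equation
  prescribes for functions \<open>v\<close> below \<open>u\<close>, which may depend on the time. The constant \<open>p\<close> is the one
  that makes the right-hand side of the equation for \<open>u\<close> monotone; it may be enlarged, so \<open>p \<ge> 1\<close> is no restriction.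
\<close>

locale growing_flow =
  fixes k :: space_kind and m \<kappa> \<theta> p :: real and b :: "real ^ 'd \<Rightarrow> real"
    and G :: "(real ^ 'd \<Rightarrow> real) \<Rightarrow> real ^ 'd \<Rightarrow> real" and u :: "real \<Rightarrow> real ^ 'd \<Rightarrow> real"
  assumes m_pos: "0 < m" and \<theta>_pos: "0 < \<theta>" and p_ge_1: "1 \<le> p" and supercritical: "m < \<kappa>"
    and kernel: "prob_kernel b"
    and maps: "maps_E k G"
    and range: "G_range k m \<kappa> G \<theta>"
    and lipschitz: "G_lipschitz k G \<theta>"
    and positive: "positive_near_0 b"
    and loc_continuous: "G_loc_continuous k G \<theta>"
    and shift_invariant: "G_shift_invariant k G \<theta>"
    and const_less: "G_const_less k m \<kappa> G \<theta>"
    and moment: "finite_first_moment b"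
    and u_nonneg: "\<And>t. 0 < t \<Longrightarrow> AE x in lborel. 0 \<le> u t x"
    and growth: "\<And>t h S g. 0 < t \<Longrightarrow> 0 \<le> h \<Longrightarrow>
      (\<And>s. t \<le> s \<Longrightarrow> s \<le> t + h \<Longrightarrow> \<exists>v \<in> E_plus k \<theta>. (AE x in lborel. v x \<le> u s x) \<and>
         (AE x in lborel. x \<in> S \<longrightarrow>
            reaction b \<kappa> G v x + p * v x \<ge> exp (- (m + p) * (s - t)) * g x)) \<Longrightarrow>
      AE x in lborel. x \<in> S \<longrightarrow> u (t + h) x \<ge> exp (- (m + p) * h) * (u t x + h * g x)"

context growing_flow
begin

lemma kernel_facts:
  "integrable lborel b" "AE y in lborel. 0 \<le> b y" "(LINT y|lborel. b y) = 1"
  "b \<in> borel_measurable borel" "integrable lborel (\<lambda>y. norm y * b y)"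
  using kernel moment unfolding prob_kernel_def finite_first_moment_def
  by (auto dest: borel_measurable_integrable)

lemma \<kappa>_pos: "0 < \<kappa>" using m_pos supercritical by simp

lemma conv_nonneg:
  assumes "v \<in> borel_measurable borel" "\<And>x. 0 \<le> v x" shows "0 \<le> conv b v x"
  unfolding conv_commute[OF kernel_facts(4) assms(1)]
  by (rule integral_nonneg_AE) (use kernel_facts(2) assms(2) in auto)

lemma G_space_E: "v \<in> E_plus k \<theta> \<Longrightarrow> G v \<in> space_E k"
  using maps by (auto simp: maps_E_def E_plus_def)

lemma G_AE_lipschitz:
  obtains l where "l > 0" "\<And>v w e. v \<in> E_plus k \<theta> \<Longrightarrow> w \<in> E_plus k \<theta> \<Longrightarrow> (\<And>x. \<bar>v x - w x\<bar> \<le> e) \<Longrightarrow>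
    AE x in lborel. \<bar>G v x - G w x\<bar> \<le> l * e"
proof -
  obtain l where l: "l > 0" "\<And>v w. v \<in> E_plus k \<theta> \<Longrightarrow> w \<in> E_plus k \<theta> \<Longrightarrow>
      norm_E k (\<lambda>x. G v x - G w x) \<le> l * norm_E k (\<lambda>x. v x - w x)"
    using lipschitz unfolding G_lipschitz_def by blast
  show ?thesis
  proof (rule that[OF l(1)])
    fix v w :: "real ^ 'd \<Rightarrow> real" and e assume vw: "v \<in> E_plus k \<theta>" "w \<in> E_plus k \<theta>" and e: "\<And>x. \<bar>v x - w x\<bar> \<le> e"
    have "norm_E k (\<lambda>x. v x - w x) \<le> e"
      using vw e by (intro norm_E_le space_E_diff) (auto simp: E_plus_def)
    then have "norm_E k (\<lambda>x. G v x - G w x) \<le> l * e"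
      using l(2)[OF vw] mult_left_mono[of "norm_E k (\<lambda>x. v x - w x)" e l] l(1) by linarith
    with norm_E_bound[OF space_E_diff[OF vw[THEN G_space_E]]]
    show "AE x in lborel. \<bar>G v x - G w x\<bar> \<le> l * e"
      by (auto elim!: eventually_mono)
  qed
qed

lemma zero_E_plus: "(\<lambda>x. 0) \<in> E_plus k \<theta>"
  using bump_E_plus[of 1 0 \<theta>] \<theta>_pos by simp

text \<open>Taking \<open>v = 0\<close> in the growth property: the solution decays at most exponentially.\<close>

lemma decay_lower_bound:
  assumes "0 < t" "0 \<le> h" shows "AE x in lborel. exp (- (m + p) * h) * u t x \<le> u (t + h) x"
proof -
  have "reaction b \<kappa> G (\<lambda>x. 0) x = 0" for x by (simp add: reaction_def conv_def)
  then have "AE x in lborel. x \<in> UNIV \<longrightarrow> u (t + h) x \<ge> exp (- (m + p) * h) * (u t x + h * 0)"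
    using assms zero_E_plus u_nonneg
    by (intro growth[where g = "\<lambda>x. 0"]) (auto intro!: bexI[of _ "\<lambda>x. 0"])
  then show ?thesis by simp
qed

text \<open>
  At amplitude \<open>e\<close> the nonlinear loss rate \<open>G\<close> is at most \<open>l e\<close>, so that the growth is bounded
  below by a linear operator. One explicit step of that linear equation is below the solution.
\<close>

lemma linear_step:
  obtains l where "l > 0" "\<And>e v t h. 0 < e \<Longrightarrow> e \<le> \<theta> \<Longrightarrow> v \<in> space_E k \<Longrightarrow>
    (\<And>x. 0 \<le> v x) \<Longrightarrow> (\<And>x. v x \<le> e) \<Longrightarrow> 0 < t \<Longrightarrow> 0 \<le> h \<Longrightarrow> AE x in lborel. v x \<le> u t x \<Longrightarrow>
    AE x in lborel.
      exp (- (m + p) * h) * (v x + h * (\<kappa> * conv b v x + (p - l * e) * v x)) \<le> u (t + h) x"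
proof -
  obtain l where l: "l > 0" "\<And>v w e. v \<in> E_plus k \<theta> \<Longrightarrow> w \<in> E_plus k \<theta> \<Longrightarrow> (\<And>x. \<bar>v x - w x\<bar> \<le> e) \<Longrightarrow>
    AE x in lborel. \<bar>G v x - G w x\<bar> \<le> l * e" using G_AE_lipschitz by blast
  show ?thesis
  proof (rule that[OF l(1)])
    fix e t h :: real and v :: "real ^ 'd \<Rightarrow> real"
    assume e: "0 < e" "e \<le> \<theta>" and v: "v \<in> space_E k" "\<And>x. 0 \<le> v x" "\<And>x. v x \<le> e"
      and th: "0 < t" "0 \<le> h" and vu: "AE x in lborel. v x \<le> u t x"
    have G0: "AE x in lborel. G (\<lambda>x. 0) x = 0"
      using range eqE_imp_AE[of k "G (\<lambda>x. 0)" "\<lambda>x. 0"] unfolding G_range_def by blast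
    have "AE x in lborel. x \<in> UNIV \<longrightarrow> u (t + h) x \<ge>
       exp (- (m + p) * h) * (u t x + h * (\<kappa> * conv b v x + (p - l * e) * v x))"
    proof (rule growth[OF th])
      fix s assume s: "t \<le> s" "s \<le> t + h"
      define c where "c = exp (- (m + p) * (s - t))"
      have "0 \<le> (m + p) * (s - t)" using s m_pos p_ge_1 by (intro mult_nonneg_nonneg) auto
      then have "- (m + p) * (s - t) \<le> 0"
        by (simp only: minus_mult_left[symmetric] neg_le_0_iff_le)
      then have c: "0 < c" "c \<le> 1" by (simp_all only: c_def exp_le_one_iff exp_gt_zero)
      have cv: "0 \<le> c * v x" "c * v x \<le> e" for x
        using c v(2)[of x] v(3)[of x] mult_right_mono[of c 1 "v x"] by (auto simp: mult_nonneg_nonneg)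
      have cvE: "(\<lambda>x. c * v x) \<in> E_plus k \<theta>"
        using space_E_lin[OF v(1) v(1), of c 0] cv e
        by (intro E_plus_I) (auto intro: order.trans)
      show "\<exists>w \<in> E_plus k \<theta>. (AE x in lborel. w x \<le> u s x) \<and>
         (AE x in lborel. x \<in> UNIV \<longrightarrow> reaction b \<kappa> G w x + p * w x
            \<ge> exp (- (m + p) * (s - t)) * (\<kappa> * conv b v x + (p - l * e) * v x))"
      proof (intro bexI[OF _ cvE] conjI)
        have "AE x in lborel. c * u t x \<le> u s x"
          using decay_lower_bound[of t "s - t"] th s by (simp add: c_def)
        with vu show "AE x in lborel. c * v x \<le> u s x"
        proof eventually_elim
          case (elim x)
          then have "c * v x \<le> c * u t x" using c by (intro mult_left_mono) auto
          then show ?case using elim by linarith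
        qed
        have "\<bar>c * v x - 0\<bar> \<le> e" for x using cv[of x] by simp
        from l(2)[OF cvE zero_E_plus this] G0
        show "AE x in lborel. x \<in> UNIV \<longrightarrow> reaction b \<kappa> G (\<lambda>x. c * v x) x + p * (c * v x)
            \<ge> exp (- (m + p) * (s - t)) * (\<kappa> * conv b v x + (p - l * e) * v x)"
        proof eventually_elim
          case (elim x)
          have "c * v x * G (\<lambda>x. c * v x) x \<le> c * v x * (l * e)"
            using elim cv by (intro mult_left_mono) auto
          then show ?case unfolding c_def[symmetric]
            by (simp add: reaction_def conv_cmult algebra_simps)
        qed
      qed
    qed
    with vu show "AE x in lborel.
      exp (- (m + p) * h) * (v x + h * (\<kappa> * conv b v x + (p - l * e) * v x)) \<le> u (t + h) x"
    proof eventually_elim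
      case (elim x)
      have "exp (- (m + p) * h) * (v x + h * (\<kappa> * conv b v x + (p - l * e) * v x))
         \<le> exp (- (m + p) * h) * (u t x + h * (\<kappa> * conv b v x + (p - l * e) * v x))"
        using elim(1) by (intro mult_left_mono add_right_mono) auto
      also have "\<dots> \<le> u (t + h) x" using elim(2) by blast
      finally show ?case .
    qed
  qed
qed

lemma positivity_step:
  assumes \<rho>: "0 < \<rho>" "\<rho> \<le> R" "AE y in lborel. y \<in> ball 0 \<rho> \<longrightarrow> \<rho> \<le> b y"
    and th: "0 < t" "0 < h" and \<eta>: "0 < \<eta>" "AE x in lborel. x \<in> ball x0 R \<longrightarrow> \<eta> \<le> u t x"
  shows "\<exists>\<eta>'>0. AE x in lborel. x \<in> ball x0 (R + \<rho> / 2) \<longrightarrow> \<eta>' \<le> u (t + h) x"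
proof -
  obtain l where l: "l > 0" "\<And>e v t h. 0 < e \<Longrightarrow> e \<le> \<theta> \<Longrightarrow> v \<in> space_E k \<Longrightarrow>
    (\<And>x. 0 \<le> v x) \<Longrightarrow> (\<And>x. v x \<le> e) \<Longrightarrow> 0 < t \<Longrightarrow> 0 \<le> h \<Longrightarrow> AE x in lborel. v x \<le> u t x \<Longrightarrow>
    AE x in lborel.
      exp (- (m + p) * h) * (v x + h * (\<kappa> * conv b v x + (p - l * e) * v x)) \<le> u (t + h) x"
    using linear_step by blast
  \<comment> \<open>\<open>e \<le> 1 / l\<close> makes the coefficient \<open>p - l e\<close> nonnegative\<close>
  define e where "e = min \<eta> (min \<theta> (1 / l))"
  have e: "0 < e" "e \<le> \<theta>" "e \<le> \<eta>" "e \<le> 1 / l" using \<eta> \<theta>_pos l by (auto simp: e_def)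
  then have le: "l * e \<le> p" using p_ge_1 l(1) by (simp add: field_simps)
  have R: "0 < R" using \<rho> by simp
  define v where "v x = e * bump R x0 x" for x
  have v: "v \<in> space_E k" "\<And>x. 0 \<le> v x" "\<And>x. v x \<le> e"
    using e bump_space_E[OF R, of e x0 k] by (auto simp: v_def[abs_def] mult_left_le)
  have vm: "v \<in> borel_measurable borel" by (rule space_E_measurable[OF v(1)])
  have "AE x in lborel. v x \<le> u t x"
    using \<eta>(2) u_nonneg[OF th(1)]
  proof eventually_elim
    case (elim x)
    show ?case
    proof (cases "x \<in> ball x0 R")
      case True
      then show ?thesis using elim v(3)[of x] e by auto
    next
      case False
      then have "v x = 0" using R by (simp add: v_def bump_eq_0 dist_norm norm_minus_commute)
      then show ?thesis using elim by simp
    qed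
  qed
  from l(2)[OF e(1,2) v th(1) less_imp_le[OF th(2)] this]
  have step: "AE x in lborel.
      exp (- (m + p) * h) * (v x + h * (\<kappa> * conv b v x + (p - l * e) * v x)) \<le> u (t + h) x" .
  define s where "s = e * (\<rho> / (8 * R))"
  define V where "V = measure lborel (ball (0 :: real ^ 'd) (\<rho> / 8))"
  have V: "V > 0" using \<rho>(1) by (simp add: V_def)
  have s: "s > 0" using e \<rho> R by (simp add: s_def)
  have conv: "\<rho> * s * V \<le> conv b v x" if x: "x \<in> ball x0 (R + \<rho> / 2)" for x
  proof -
    let ?D = "norm (x - x0)"
    have D: "?D < R + \<rho> / 2" using x by (simp add: dist_norm norm_minus_commute)
    \<comment> \<open>a point of the segment from \<open>x0\<close> to \<open>x\<close>, in the ball by a margin and not far from \<open>x\<close>\<close>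
    have "\<exists>q. norm (q - x0) \<le> R - \<rho> / 4 \<and> norm (x - q) \<le> 3 * \<rho> / 4"
    proof (cases "?D \<le> R - \<rho> / 4")
      case True
      then show ?thesis using \<rho> by (intro exI[of _ x]) auto
    next
      case False
      define a where "a = (R - \<rho> / 4) / ?D"
      have D0: "?D > 0" using False \<rho> by auto
      have a: "0 \<le> a" "a \<le> 1" using False \<rho> D0 by (auto simp: a_def)
      have aD: "a * ?D = R - \<rho> / 4" using D0 by (simp add: a_def)
      show ?thesis
      proof (intro exI[of _ "x0 + a *\<^sub>R (x - x0)"] conjI)
        show "norm (x0 + a *\<^sub>R (x - x0) - x0) \<le> R - \<rho> / 4" using a aD by simp
        have "x - (x0 + a *\<^sub>R (x - x0)) = (1 - a) *\<^sub>R (x - x0)" by (simp add: algebra_simps)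
        then have "norm (x - (x0 + a *\<^sub>R (x - x0))) = (1 - a) * ?D" using a by simp
        also have "\<dots> = ?D - (R - \<rho> / 4)" using aD by (simp add: algebra_simps)
        finally show "norm (x - (x0 + a *\<^sub>R (x - x0))) \<le> 3 * \<rho> / 4" using D by simp
      qed
    qed
    then obtain q where q: "norm (q - x0) \<le> R - \<rho> / 4" "norm (x - q) \<le> 3 * \<rho> / 4" by auto
    show ?thesis unfolding V_def
    proof (rule conv_lower_bound_ball[OF kernel_facts(1,2) \<rho>(3) vm v(2,3), where q = q])
      fix y assume y: "y \<in> ball q (\<rho> / 8)"
      then have yq: "norm (y - q) < \<rho> / 8" by (simp add: dist_norm norm_minus_commute)
      have "norm (x - y) \<le> norm (x - q) + norm (y - q)"
        using norm_triangle_ineq4[of "x - q" "y - q"] by simp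
      moreover have "norm (y - x0) \<le> norm (y - q) + norm (q - x0)"
        using norm_triangle_ineq[of "y - q" "q - x0"] by simp
      ultimately have n: "norm (x - y) < \<rho>" "norm (y - x0) \<le> R - \<rho> / 8" using q yq \<rho> by auto
      have "norm (y - x0) / R \<le> 1 - \<rho> / (8 * R)" using n R by (simp add: field_simps)
      moreover have "0 \<le> norm (y - x0) / R" "1 - \<rho> / (8 * R) \<le> 1" using R \<rho> by auto
      ultimately have "(norm (y - x0) / R)\<^sup>2 \<le> 1 - \<rho> / (8 * R)"
        by (smt (verit) power2_eq_square mult_left_le mult_mono)
      then have "\<rho> / (8 * R) \<le> bump R x0 y" by (simp add: bump_def)
      then have "s \<le> v y" unfolding s_def v_def using e(1) by (intro mult_left_mono) auto
      with n show "norm (x - y) < \<rho> \<and> s \<le> v y" by simp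
    qed (use s \<rho> in auto)
  qed
  define \<eta>' where "\<eta>' = exp (- (m + p) * h) * (h * (\<kappa> * (\<rho> * s * V)))"
  have "\<eta>' > 0" using th \<kappa>_pos \<rho> s V by (simp add: \<eta>'_def)
  moreover have "AE x in lborel. x \<in> ball x0 (R + \<rho> / 2) \<longrightarrow> \<eta>' \<le> u (t + h) x"
    using step
  proof eventually_elim
    case (elim x)
    show ?case
    proof
      assume x: "x \<in> ball x0 (R + \<rho> / 2)"
      have "h * (\<kappa> * (\<rho> * s * V)) \<le> h * (\<kappa> * conv b v x)"
        using conv[OF x] th \<kappa>_pos by (intro mult_left_mono) auto
      also have "\<dots> \<le> v x + h * (\<kappa> * conv b v x + (p - l * e) * v x)"
        using v(2)[of x] le th by (simp add: distrib_left mult_nonneg_nonneg)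
      finally have "\<eta>' \<le> exp (- (m + p) * h) * (v x + h * (\<kappa> * conv b v x + (p - l * e) * v x))"
        unfolding \<eta>'_def by (intro mult_left_mono) auto
      then show "\<eta>' \<le> u (t + h) x" using elim by linarith
    qed
  qed
  ultimately show ?thesis by blast
qed

text \<open>Positivity spreads with infinite speed: the time steps can be taken arbitrarily short.\<close>

lemma positive_on_balls:
  assumes "0 < t1" "0 < \<delta>" "0 < \<eta>" "AE x in lborel. x \<in> ball x0 \<delta> \<longrightarrow> \<eta> \<le> u t1 x" "t1 < t"
  shows "\<exists>\<eta>>0. AE x in lborel. x \<in> ball x0 R \<longrightarrow> \<eta> \<le> u t x"
proof -
  obtain \<rho>0 where \<rho>0: "\<rho>0 > 0" "AE y in lborel. y \<in> ball 0 \<rho>0 \<longrightarrow> \<rho>0 \<le> b y"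
    using positive unfolding positive_near_0_def by blast
  define \<rho> where "\<rho> = min \<rho>0 \<delta>"
  have \<rho>: "0 < \<rho>" "\<rho> \<le> \<delta>" "AE y in lborel. y \<in> ball 0 \<rho> \<longrightarrow> \<rho> \<le> b y"
  proof -
    show "0 < \<rho>" "\<rho> \<le> \<delta>" using \<rho>0 assms by (auto simp: \<rho>_def)
    show "AE y in lborel. y \<in> ball 0 \<rho> \<longrightarrow> \<rho> \<le> b y"
      using \<rho>0(2) by eventually_elim (auto simp: \<rho>_def)
  qed
  have *: "\<exists>\<eta>>0. AE x in lborel. x \<in> ball x0 (\<delta> + real n * (\<rho> / 2)) \<longrightarrow> \<eta> \<le> u t x" if "t1 < t" for n t
    using that
  proof (induction n arbitrary: t)
    case 0
    define c where "c = exp (- (m + p) * (t - t1))"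
    have "AE x in lborel. c * u t1 x \<le> u t x"
      using decay_lower_bound[of t1 "t - t1"] assms 0 by (simp add: c_def)
    with assms(4) have "AE x in lborel. x \<in> ball x0 \<delta> \<longrightarrow> c * \<eta> \<le> u t x"
    proof eventually_elim
      case (elim x)
      have "c > 0" by (simp add: c_def)
      show ?case
      proof
        assume "x \<in> ball x0 \<delta>"
        then have "c * \<eta> \<le> c * u t1 x" using elim \<open>c > 0\<close> by (intro mult_left_mono) auto
        then show "c * \<eta> \<le> u t x" using elim by linarith
      qed
    qed
    moreover have "c * \<eta> > 0" using assms by (simp add: c_def)
    ultimately show ?case by (auto intro!: exI[of _ "c * \<eta>"])
  next
    case (Suc n)
    define r where "r = \<delta> + real n * (\<rho> / 2)"
    obtain \<eta>1 where \<eta>1: "\<eta>1 > 0" "AE x in lborel. x \<in> ball x0 r \<longrightarrow> \<eta>1 \<le> u ((t1 + t) / 2) x"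
      unfolding r_def using Suc.IH[of "(t1 + t) / 2"] Suc.prems by auto
    have "\<rho> \<le> r" using \<rho> by (simp add: r_def add_increasing2)
    from positivity_step[OF \<rho>(1) this \<rho>(3) _ _ \<eta>1, of "(t - t1) / 2"]
    have "\<exists>\<eta>'>0. AE x in lborel. x \<in> ball x0 (r + \<rho> / 2) \<longrightarrow> \<eta>' \<le> u ((t1 + t) / 2 + (t - t1) / 2) x"
      using Suc.prems assms(1) by simp
    moreover have "(t1 + t) / 2 + (t - t1) / 2 = t" by (simp add: field_simps)
    moreover have "r + \<rho> / 2 = \<delta> + real (Suc n) * (\<rho> / 2)" by (simp add: r_def field_simps)
    ultimately show ?case by simp
  qed
  obtain n where n: "R \<le> \<delta> + real n * (\<rho> / 2)"
  proof -
    obtain n where "R / (\<rho> / 2) < real n" using reals_Archimedean2 by blast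
    then have "R < real n * (\<rho> / 2)" using \<rho>(1) by (simp add: field_simps)
    then show ?thesis using that assms(2) by (metis add_increasing less_eq_real_def)
  qed
  obtain \<eta>2 where \<eta>2: "\<eta>2 > 0"
      "AE x in lborel. x \<in> ball x0 (\<delta> + real n * (\<rho> / 2)) \<longrightarrow> \<eta>2 \<le> u t x"
    using *[OF assms(5)] by blast
  from \<eta>2(2) have "AE x in lborel. x \<in> ball x0 R \<longrightarrow> \<eta>2 \<le> u t x"
    by eventually_elim (use n in auto)
  with \<eta>2(1) show ?thesis by blast
qed

end

section \<open>A growing bump that moves with the drift\<close>

lemma kernel_tail_small:
  fixes b :: "real ^ 'd \<Rightarrow> real"
  assumes "integrable lborel (\<lambda>y. norm y * b y)" "e > 0"
  shows "\<exists>R\<ge>r. \<bar>LINT y|lborel. norm y * b y * indicator {y. R < norm y} y\<bar> < e"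
proof -
  have [measurable]: "(\<lambda>y. norm y * b y) \<in> borel_measurable borel"
    using assms(1) by (auto dest: borel_measurable_integrable)
  have "(\<lambda>n. LINT y|lborel. norm y * b y * indicator {y. real n < norm y} y)
      \<longlonglongrightarrow> (LINT (y :: real ^ 'd)|lborel. 0)"
  proof (rule integral_dominated_convergence[where w = "\<lambda>y. \<bar>norm y * b y\<bar>"])
    show "AE y in lborel. (\<lambda>n. norm y * b y * indicator {y. real n < norm y} y) \<longlonglongrightarrow> 0"
    proof (rule AE_I2)
      fix y :: "real ^ 'd"
      have "eventually (\<lambda>n. norm y * b y * indicator {y. real n < norm y} y = 0) sequentially"
        using eventually_ge_at_top[of "nat \<lceil>norm y\<rceil>"]
      proof eventually_elim
        case (elim n)
        then have "norm y \<le> real n" by linarith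
        then show ?case by simp
      qed
      then show "(\<lambda>n. norm y * b y * indicator {y. real n < norm y} y) \<longlonglongrightarrow> 0"
        by (rule tendsto_eventually)
    qed
    show "AE y in lborel. norm (norm y * b y * indicator {y. real n < norm y} y) \<le> \<bar>norm y * b y\<bar>" for n
      by (auto simp: indicator_def)
  qed (use assms(1) in auto)
  then have "eventually (\<lambda>n. \<bar>LINT y|lborel. norm y * b y * indicator {y. real n < norm y} y\<bar> < e) sequentially"
    using assms(2) by (auto dest!: tendstoD simp: dist_real_def)
  with eventually_ge_at_top[of "nat \<lceil>r\<rceil>"]
  have "eventually (\<lambda>n. real n \<ge> r \<and> \<bar>LINT y|lborel. norm y * b y * indicator {y. real n < norm y} y\<bar> < e) sequentially"
    by eventually_elim linarith
  then obtain n where "real n \<ge> r" "\<bar>LINT y|lborel. norm y * b y * indicator {y. real n < norm y} y\<bar> < e"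
    using eventually_happens'[OF sequentially_bot] by blast
  then show ?thesis by blast
qed

text \<open>
  The arithmetic of one step, where \<open>C\<close> is the value of the convolution at a point, \<open>max 0 \<tau>\<close> the
  value of the bump there, \<open>X\<close> the value of the translated bump, and \<open>K\<close>, \<open>N\<close> the gain and the losses in
  the lower bound for the convolution.
\<close>

lemma bump_step_arith:
  fixes \<kappa> q r h \<tau> D N T K C X d :: real
  assumes "0 \<le> h" "0 \<le> r" "0 < X" "X \<le> \<tau> + D" "\<bar>D\<bar> \<le> h * d"
    and C: "h * (\<kappa> * C) \<ge> h * (\<kappa> * \<tau>) + D - h * N - h * (\<kappa> * T * \<bar>\<tau>\<bar>) + h * K"
    and pos: "\<tau> \<ge> 0 \<Longrightarrow> N + r * (h * d) \<le> (\<kappa> + q - r - \<kappa> * T) * \<tau> + K"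
    and neg: "\<tau> < 0 \<Longrightarrow> N + r * (h * d) \<le> K"
    and small: "h * \<kappa> + h * (\<kappa> * T) \<le> 1"
  shows "(1 + h * r) * X \<le> max 0 \<tau> + h * (\<kappa> * C + q * max 0 \<tau>)"
proof -
  have "(1 + h * r) * X \<le> (1 + h * r) * (\<tau> + D)"
    using assms(1,2,4) by (intro mult_left_mono) auto
  also have "\<dots> = \<tau> + D + h * r * \<tau> + h * (r * D)" by (simp add: algebra_simps)
  also have "h * (r * D) \<le> h * (r * (h * d))"
    using assms(1,2,5) by (intro mult_left_mono) auto
  finally have X: "(1 + h * r) * X \<le> \<tau> + D + h * r * \<tau> + h * (r * (h * d))" by simp
  show ?thesis
  proof (cases "\<tau> \<ge> 0")
    case True
    have "h * (N + r * (h * d)) \<le> h * ((\<kappa> + q - r - \<kappa> * T) * \<tau> + K)"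
      using pos[OF True] assms(1) by (intro mult_left_mono) auto
    then show ?thesis using X C True by (simp add: algebra_simps)
  next
    case False
    have "h * (N + r * (h * d)) \<le> h * K"
      using neg False assms(1) by (intro mult_left_mono) auto
    moreover have "\<tau> + h * r * \<tau> \<le> h * (\<kappa> * \<tau>) + h * (\<kappa> * T * \<tau>)"
    proof -
      have "(h * \<kappa> + h * (\<kappa> * T)) * \<tau> \<ge> 1 * \<tau>"
        using small False by (intro mult_right_mono_neg) auto
      moreover have "h * r * \<tau> \<le> 0" using assms(1,2) False by (simp add: mult_nonneg_nonpos)
      ultimately show ?thesis by (simp add: algebra_simps)
    qed
    ultimately show ?thesis using X C False by (simp add: algebra_simps)
  qed
qed

context growing_flow
begin

text \<open>
  One step of the linear equation maps a wide bump above a slightly larger bump translated by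
  \<open>h\<close> times the drift.
\<close>

lemma bump_conv_step:
  assumes q: "0 \<le> q" and \<sigma>: "0 < \<sigma>" and gap: "m + p + 4 * \<sigma> \<le> \<kappa> + q"
  shows "\<exists>h0>0. \<exists>L0>0. \<forall>h L x. 0 \<le> h \<and> h \<le> h0 \<and> L0 \<le> L \<longrightarrow>
     (1 + \<sigma> * h) * bump L (h *\<^sub>R drift b \<kappa>) x
       \<le> exp (- (m + p) * h) * (bump L 0 x + h * (\<kappa> * conv b (bump L 0) x + q * bump L 0 x))"
proof -
  obtain \<rho> where \<rho>: "\<rho> > 0" "AE y in lborel. y \<in> ball 0 \<rho> \<longrightarrow> \<rho> \<le> b y"
    using positive unfolding positive_near_0_def by blast
  define V where "V = measure lborel (ball (0 :: real ^ 'd) (\<rho> / 8))"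
  have V: "V > 0" using \<rho>(1) by (simp add: V_def)
  define c where "c = drift b \<kappa>"
  define m1 where "m1 = (LINT y|lborel. norm y * b y)"
  have m1: "0 \<le> m1" unfolding m1_def
    by (rule integral_nonneg_AE) (use kernel_facts(2) in auto)
  \<comment> \<open>\<open>M / L\<close> bounds from below the supercritical growth where \<open>\<tau> > \<rho> / (8 L)\<close> and the gain from the
    kink elsewhere. The tail, the width and the time step are chosen such that each of the three losses is at
    most \<open>M / (3 L)\<close>.\<close>
  define M where "M = min (\<sigma> * \<rho> / 8) (\<kappa> * (\<rho> * \<rho> * V) / 4)"
  have M: "0 < M" "M \<le> \<sigma> * \<rho> / 8" "M \<le> \<kappa> * (\<rho> * \<rho> * V) / 4"
    using \<sigma> \<rho> V \<kappa>_pos by (auto simp: M_def)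
  define e where "e = min 1 (min (M / (12 * \<kappa>)) (\<sigma> / \<kappa>))"
  have e: "0 < e" using M \<kappa>_pos \<sigma> by (simp add: e_def)
  obtain R where R: "max 1 \<rho> \<le> R"
      "\<bar>LINT y|lborel. norm y * b y * indicator {y. R < norm y} y\<bar> < e"
    using kernel_tail_small[OF kernel_facts(5) e] by blast
  define T where "T = (LINT y|lborel. norm y * b y * indicator {y. R < norm y} y)"
  have T0: "0 \<le> T" unfolding T_def
    by (rule integral_nonneg_AE) (use kernel_facts(2) in auto)
  have T: "T \<le> 1" "4 * \<kappa> * T \<le> M / 3" "\<kappa> * T \<le> \<sigma>"
  proof -
    have "T \<le> e" using R(2) by (simp add: T_def)
    then have "T \<le> 1" "T \<le> M / (12 * \<kappa>)" "T \<le> \<sigma> / \<kappa>" by (auto simp: e_def)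
    then show "T \<le> 1" "4 * \<kappa> * T \<le> M / 3" "\<kappa> * T \<le> \<sigma>"
      using \<kappa>_pos by (simp_all add: field_simps)
  qed
  define r where "r = m + p + 2 * \<sigma>"
  have r: "0 < r" using m_pos p_ge_1 \<sigma> by (simp add: r_def)
  define h0 where "h0 = min (1 / (norm c + 1)) (min (M / (12 * r * (norm c + 1)))
      (min (1 / (2 * \<kappa>)) (\<sigma> / ((m + p) * r))))"
  define L0 where "L0 = max 1 (max \<rho> (3 * \<kappa> * R * m1 / M))"
  have nc: "0 < norm c + 1" by (simp add: add_nonneg_pos)
  have mp: "0 < m + p" using m_pos p_ge_1 by simp
  have "h0 > 0" using M r nc mp \<kappa>_pos \<sigma> by (simp add: h0_def)
  moreover have "L0 > 0" by (simp add: L0_def)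
  moreover have "(1 + \<sigma> * h) * bump L (h *\<^sub>R c) x
       \<le> exp (- (m + p) * h) * (bump L 0 x + h * (\<kappa> * conv b (bump L 0) x + q * bump L 0 x))"
    (is "?l \<le> exp _ * ?Y")
    if h: "0 \<le> h" "h \<le> h0" and L: "L0 \<le> L" for h L x
  proof -
    have L1: "1 \<le> L" "\<rho> \<le> L" "3 * \<kappa> * R * m1 / M \<le> L" using L by (auto simp: L0_def)
    have Lpos: "0 < L" using L1 by simp
    have hh: "h * (norm c + 1) \<le> 1" "12 * r * h * (norm c + 1) \<le> M" "2 * h * \<kappa> \<le> 1"
        "h * ((m + p) * r) \<le> \<sigma>"
    proof -
      have "h \<le> 1 / (norm c + 1)" "h \<le> M / (12 * r * (norm c + 1))" "h \<le> 1 / (2 * \<kappa>)"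
        "h \<le> \<sigma> / ((m + p) * r)" using h(2) by (auto simp: h0_def)
      then show "h * (norm c + 1) \<le> 1" "12 * r * h * (norm c + 1) \<le> M" "2 * h * \<kappa> \<le> 1"
        "h * ((m + p) * r) \<le> \<sigma>"
        using nc r mp \<kappa>_pos by (simp_all add: pos_le_divide_eq mult_ac)
    qed
    have hc: "h * norm c \<le> 1" using hh(1) h(1) by (simp add: distrib_left)
    define \<tau> where "\<tau> = 1 - (norm x / L)\<^sup>2"
    define X where "X = 1 - (norm (x - h *\<^sub>R c) / L)\<^sup>2"
    have b0: "bump L 0 x = max 0 \<tau>" by (simp add: bump_def \<tau>_def)
    have Y0: "0 \<le> ?Y"
      using h(1) \<kappa>_pos q conv_nonneg[OF bump_measurable, of L 0 x] by simp
    show "?l \<le> exp (- (m + p) * h) * ?Y"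
    proof (cases "X > 0")
      case False
      then have "bump L (h *\<^sub>R c) x = 0" by (simp add: bump_def X_def)
      then show ?thesis using Y0 by simp
    next
      case True
      then have bX: "bump L (h *\<^sub>R c) x = X" by (simp add: bump_def X_def)
      have "norm (x - h *\<^sub>R c) / L < 1"
        using True unfolding X_def by (smt (verit) one_le_power)
      then have "norm (x - h *\<^sub>R c) < L" using Lpos by simp
      then have "norm x < L + h * norm c"
        using norm_triangle_sub[of x "h *\<^sub>R c"] h(1) by simp
      then have x2: "norm x \<le> 2 * L" using hc L1 by simp
      define D where "D = 2 * h * (x \<bullet> c) / L\<^sup>2"
      define d where "d = 4 * norm c / L"
      have XD: "X \<le> \<tau> + D"
      proof -
        have "norm (x - h *\<^sub>R c) ^ 2 = norm x ^ 2 - 2 * h * (x \<bullet> c) + (h * norm c)\<^sup>2"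
          by (simp add: power2_norm_eq_inner inner_diff_left inner_diff_right inner_commute
              power_mult_distrib algebra_simps power2_eq_square[of h])
        then have "X = \<tau> + D - (h * norm c)\<^sup>2 / L\<^sup>2"
          by (simp add: X_def \<tau>_def D_def power_divide diff_divide_distrib add_divide_distrib)
        then show ?thesis by simp
      qed
      have Dd: "\<bar>D\<bar> \<le> h * d"
      proof -
        have "\<bar>x \<bullet> c\<bar> \<le> norm x * norm c" by (rule Cauchy_Schwarz_ineq2)
        also have "\<dots> \<le> 2 * L * norm c" using x2 by (intro mult_right_mono) auto
        finally have "2 * h / L\<^sup>2 * \<bar>x \<bullet> c\<bar> \<le> 2 * h / L\<^sup>2 * (2 * L * norm c)"
          using h(1) by (intro mult_left_mono) auto
        also have "\<dots> = h * d" using Lpos by (simp add: d_def power2_eq_square)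
        finally show ?thesis using h(1) by (simp add: D_def abs_mult)
      qed
      define K where "K = (if \<tau> \<le> \<rho> / (8 * L) then \<rho> / (4 * L) else 0)"
      have K: "K = 0 \<or> K = \<rho> / (4 * L) \<and> L / 2 \<le> norm x \<and> \<tau> \<le> \<rho> / (8 * L)"
      proof (cases "\<tau> \<le> \<rho> / (8 * L)")
        case True
        have "\<rho> / (8 * L) \<le> 3 / 4" using L1 Lpos by (simp add: field_simps)
        then have "1 / 4 \<le> (norm x / L)\<^sup>2" using True by (simp add: \<tau>_def)
        then have "(1 / 2)\<^sup>2 \<le> (norm x / L)\<^sup>2" by (simp add: power2_eq_square)
        then have "1 / 2 \<le> norm x / L"
          using Lpos by (subst (asm) power_mono_iff) auto
        then show ?thesis using True Lpos by (simp add: K_def field_simps)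
      qed (simp add: K_def)
      define N where "N = \<kappa> * R * m1 / L\<^sup>2 + 4 * \<kappa> * T / L"
      have "conv b (bump L 0) x \<ge> \<tau> + 2 / L\<^sup>2 * (x \<bullet> (LINT y|lborel. b y *\<^sub>R y))
         - R / L\<^sup>2 * m1 - (\<bar>\<tau>\<bar> + 4 / L) * T + K * \<rho> * V"
        unfolding m1_def V_def
        by (rule conv_bump_lower_bound[OF kernel_facts(1-3) \<rho>(2) kernel_facts(5) _ \<rho>(1) _ Lpos x2 \<tau>_def K T_def])
           (use R in auto)
      then have "h * \<kappa> * conv b (bump L 0) x \<ge> h * \<kappa> * (\<tau> + 2 / L\<^sup>2 * (x \<bullet> (LINT y|lborel. b y *\<^sub>R y))
         - R / L\<^sup>2 * m1 - (\<bar>\<tau>\<bar> + 4 / L) * T + K * \<rho> * V)"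
        using h(1) \<kappa>_pos by (intro mult_left_mono) auto
      moreover have "h * \<kappa> * (2 / L\<^sup>2 * (x \<bullet> (LINT y|lborel. b y *\<^sub>R y))) = D"
        by (simp add: D_def c_def drift_def)
      ultimately have C: "h * (\<kappa> * conv b (bump L 0) x) \<ge> h * (\<kappa> * \<tau>) + D - h * N
          - h * (\<kappa> * T * \<bar>\<tau>\<bar>) + h * (\<kappa> * (K * \<rho> * V))"
        by (simp add: N_def algebra_simps)
      have loss: "N + r * (h * d) \<le> M / L"
      proof -
        have "3 * \<kappa> * R * m1 \<le> L * M" using L1(3) M(1) by (simp add: pos_divide_le_eq)
        then have "\<kappa> * R * m1 / L \<le> M / 3" using Lpos by (simp add: field_simps)
        moreover have "r * h * 4 * norm c \<le> M / 3"
        proof -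
          have "12 * r * h * norm c \<le> 12 * r * h * (norm c + 1)"
            using r h(1) by (intro mult_left_mono) auto
          then show ?thesis using hh(2) by simp
        qed
        ultimately have "\<kappa> * R * m1 / L + 4 * \<kappa> * T + r * h * 4 * norm c \<le> M"
          using T(2) by linarith
        then have "(\<kappa> * R * m1 / L + 4 * \<kappa> * T + r * h * 4 * norm c) / L \<le> M / L"
          using Lpos by (intro divide_right_mono) auto
        then show ?thesis by (simp add: N_def d_def add_divide_distrib power2_eq_square mult_ac)
      qed
      have gainK: "M / L \<le> \<kappa> * (K * \<rho> * V)" if "\<tau> \<le> \<rho> / (8 * L)"
        using that M(3) Lpos by (simp add: K_def field_simps)
      \<comment> \<open>\<open>r\<close> exceeds \<open>m + p\<close> by \<open>2 \<sigma>\<close>: one \<open>\<sigma>\<close> provides the growth factor \<open>1 + \<sigma> h\<close>, the other absorbs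
        the second order terms in \<open>h\<close>\<close>
      have "(1 + h * r) * X \<le> ?Y"
        unfolding b0
      proof (rule bump_step_arith[OF h(1) less_imp_le[OF r] True XD Dd C])
        assume \<tau>: "\<tau> \<ge> 0"
        have "\<sigma> \<le> \<kappa> + q - r - \<kappa> * T" using gap T(3) by (simp add: r_def)
        then have co: "\<sigma> * \<tau> \<le> (\<kappa> + q - r - \<kappa> * T) * \<tau>" using \<tau> by (rule mult_right_mono)
        show "N + r * (h * d) \<le> (\<kappa> + q - r - \<kappa> * T) * \<tau> + \<kappa> * (K * \<rho> * V)"
        proof (cases "\<tau> \<le> \<rho> / (8 * L)")
          case True
          moreover have "0 \<le> \<sigma> * \<tau>" using \<tau> \<sigma> by simp
          ultimately show ?thesis using loss gainK co by linarith
        next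
          case False
          have "M / L \<le> (\<sigma> * \<rho> / 8) / L" using M(2) Lpos by (intro divide_right_mono) auto
          also have "\<dots> = \<sigma> * (\<rho> / (8 * L))" by simp
          also have "\<dots> \<le> \<sigma> * \<tau>" using False \<sigma> by (intro mult_left_mono) auto
          finally show ?thesis using False loss co by (simp add: K_def)
        qed
      next
        assume "\<tau> < 0"
        then have "\<tau> \<le> \<rho> / (8 * L)" using \<rho>(1) Lpos by (auto intro: order.trans[of _ 0])
        then show "N + r * (h * d) \<le> \<kappa> * (K * \<rho> * V)" using loss gainK by linarith
      next
        have "h * \<kappa> * T \<le> h * \<kappa> * 1" using T(1) h(1) \<kappa>_pos by (intro mult_left_mono) auto
        then show "h * \<kappa> + h * (\<kappa> * T) \<le> 1" using hh(3) by (simp add: mult_ac)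
      qed
      moreover have "(1 + \<sigma> * h) \<le> exp (- (m + p) * h) * (1 + h * r)"
      proof -
        have "h * (h * ((m + p) * r)) \<le> h * \<sigma>" using hh(4) h(1) by (rule mult_left_mono)
        then have "1 + \<sigma> * h \<le> (1 - (m + p) * h) * (1 + h * r)"
          by (simp add: r_def algebra_simps)
        also have "\<dots> \<le> exp (- (m + p) * h) * (1 + h * r)"
        proof (rule mult_right_mono)
          show "1 - (m + p) * h \<le> exp (- (m + p) * h)"
            using exp_ge_add_one_self[of "- (m + p) * h"]
            by (simp only: minus_mult_left[symmetric] add_uminus_conv_diff)
        qed (use h(1) r in simp)
        finally show ?thesis .
      qed
      ultimately have "(1 + \<sigma> * h) * X \<le> exp (- (m + p) * h) * (1 + h * r) * X"
        and "exp (- (m + p) * h) * ((1 + h * r) * X) \<le> exp (- (m + p) * h) * ?Y"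
        using True by (intro mult_right_mono mult_left_mono; simp only: exp_ge_zero less_imp_le)+
      then show ?thesis unfolding bX mult.assoc by (rule order.trans)
    qed
  qed
  ultimately show ?thesis unfolding c_def by blast
qed


lemma bump_step:
  obtains e \<sigma> h0 L0 where "0 < e" "e \<le> \<theta>" "0 < \<sigma>" "0 < h0" "0 < L0"
    "\<And>A t h L z. 0 \<le> A \<Longrightarrow> A \<le> e \<Longrightarrow> 0 < t \<Longrightarrow> 0 \<le> h \<Longrightarrow> h \<le> h0 \<Longrightarrow> L0 \<le> L \<Longrightarrow>
       AE x in lborel. A * bump L z x \<le> u t x \<Longrightarrow>
       AE x in lborel. A * (1 + \<sigma> * h) * bump L (z + h *\<^sub>R drift b \<kappa>) x \<le> u (t + h) x"
proof -
  obtain l where l: "l > 0" "\<And>e v t h. 0 < e \<Longrightarrow> e \<le> \<theta> \<Longrightarrow> v \<in> space_E k \<Longrightarrow>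
    (\<And>x. 0 \<le> v x) \<Longrightarrow> (\<And>x. v x \<le> e) \<Longrightarrow> 0 < t \<Longrightarrow> 0 \<le> h \<Longrightarrow> AE x in lborel. v x \<le> u t x \<Longrightarrow>
    AE x in lborel.
      exp (- (m + p) * h) * (v x + h * (\<kappa> * conv b v x + (p - l * e) * v x)) \<le> u (t + h) x"
    using linear_step by blast
  \<comment> \<open>at this amplitude at least half of the linear growth rate \<open>\<kappa> - m\<close> is left\<close>
  define e where "e = min \<theta> (min (1 / l) ((\<kappa> - m) / (2 * l)))"
  have e: "0 < e" "e \<le> \<theta>" "l * e \<le> p" "l * e \<le> (\<kappa> - m) / 2"
  proof -
    show "0 < e" "e \<le> \<theta>" using \<theta>_pos l(1) supercritical by (auto simp: e_def)
    have "e \<le> 1 / l" "e \<le> (\<kappa> - m) / (2 * l)" by (auto simp: e_def)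
    then have "l * e \<le> 1" "l * e \<le> (\<kappa> - m) / 2" using l(1) by (simp_all add: field_simps)
    then show "l * e \<le> p" "l * e \<le> (\<kappa> - m) / 2" using p_ge_1 by auto
  qed
  define \<sigma> where "\<sigma> = (\<kappa> - m) / 8"
  have \<sigma>: "0 < \<sigma>" using supercritical by (simp add: \<sigma>_def)
  have "m + p + 4 * \<sigma> \<le> \<kappa> + (p - l * e)" using e(4) by (simp add: \<sigma>_def field_simps)
  then obtain h0 L0 where h0: "h0 > 0" "L0 > 0"
    "\<And>h L x. 0 \<le> h \<Longrightarrow> h \<le> h0 \<Longrightarrow> L0 \<le> L \<Longrightarrow> (1 + \<sigma> * h) * bump L (h *\<^sub>R drift b \<kappa>) x
      \<le> exp (- (m + p) * h) * (bump L 0 x + h * (\<kappa> * conv b (bump L 0) x + (p - l * e) * bump L 0 x))"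
    using bump_conv_step[OF _ \<sigma>, of "p - l * e"] e(3) by auto
  have "AE x in lborel. A * (1 + \<sigma> * h) * bump L (z + h *\<^sub>R drift b \<kappa>) x \<le> u (t + h) x"
    if A: "0 \<le> A" "A \<le> e" and t: "0 < t" and h: "0 \<le> h" "h \<le> h0" and L: "L0 \<le> L"
      and low: "AE x in lborel. A * bump L z x \<le> u t x" for A t h L z
  proof -
    have L': "0 < L" using L h0(2) by simp
    have "A * bump L z x \<le> e" for x
      using A by (meson bump_le_1 mult_left_le order_trans)
    then have "AE x in lborel. exp (- (m + p) * h) * (A * bump L z x
        + h * (\<kappa> * conv b (\<lambda>x. A * bump L z x) x + (p - l * e) * (A * bump L z x))) \<le> u (t + h) x"
      using A t h low by (intro l(2) e(1,2) bump_space_E[OF L']) auto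
    then show ?thesis
    proof eventually_elim
      case (elim x)
      have c: "conv b (\<lambda>x. A * bump L z x) x = A * conv b (bump L 0) (x - z)"
        by (simp add: conv_cmult bump_shift[of L z] conv_shift kernel_facts(4))
      have s: "bump L z x = bump L 0 (x - z)" "bump L (z + h *\<^sub>R drift b \<kappa>) x = bump L (h *\<^sub>R drift b \<kappa>) (x - z)"
        by (simp_all add: bump_def diff_diff_eq)
      have "A * (1 + \<sigma> * h) * bump L (z + h *\<^sub>R drift b \<kappa>) x
          = A * ((1 + \<sigma> * h) * bump L (h *\<^sub>R drift b \<kappa>) (x - z))" by (simp add: s)
      also have "\<dots> \<le> A * (exp (- (m + p) * h) * (bump L 0 (x - z)
          + h * (\<kappa> * conv b (bump L 0) (x - z) + (p - l * e) * bump L 0 (x - z))))"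
        by (intro mult_left_mono h0(3) h L A)
      also have "\<dots> = exp (- (m + p) * h) * (A * bump L z x
        + h * (\<kappa> * conv b (\<lambda>x. A * bump L z x) x + (p - l * e) * (A * bump L z x)))"
        unfolding c s by (simp only: distrib_left mult_ac)
      finally show ?case using elim by (rule order.trans)
    qed
  qed
  then show thesis by (rule that[OF e(1,2) \<sigma> h0(1,2)])
qed

text \<open>A wide bump below the solution grows to a fixed amplitude, which does not depend on its width.\<close>

lemma bump_grows:
  obtains e \<sigma> L0 where "0 < e" "e \<le> \<theta>" "0 < \<sigma>" "0 < L0"
    "\<And>A t0 t L z. 0 < A \<Longrightarrow> A \<le> e \<Longrightarrow> 0 < t0 \<Longrightarrow> t0 \<le> t \<Longrightarrow> L0 \<le> L \<Longrightarrow>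
       AE x in lborel. A * bump L z x \<le> u t0 x \<Longrightarrow>
       AE x in lborel. min e (A * (1 + \<sigma> * (t - t0)))
          * bump L (z + (t - t0) *\<^sub>R drift b \<kappa>) x \<le> u t x"
proof -
  obtain e \<sigma> h0 L0 where e: "0 < e" "e \<le> \<theta>" and pos: "0 < \<sigma>" "0 < h0" "0 < L0"
    and step: "\<And>A t h L z. 0 \<le> A \<Longrightarrow> A \<le> e \<Longrightarrow> 0 < t \<Longrightarrow> 0 \<le> h \<Longrightarrow> h \<le> h0 \<Longrightarrow> L0 \<le> L \<Longrightarrow>
        (AE x in lborel. A * bump L z x \<le> u t x) \<Longrightarrow>
        (AE x in lborel. A * (1 + \<sigma> * h) * bump L (z + h *\<^sub>R drift b \<kappa>) x \<le> u (t + h) x)"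
    by (rule bump_step) blast
  have "AE x in lborel. min e (A * (1 + \<sigma> * (t - t0))) * bump L (z + (t - t0) *\<^sub>R drift b \<kappa>) x \<le> u t x"
    if A: "0 < A" "A \<le> e" and t: "0 < t0" "t0 \<le> t" and L: "L0 \<le> L"
      and init: "AE x in lborel. A * bump L z x \<le> u t0 x" for A t0 t L z
  proof -
    define B where "B s = min e (A * (1 + \<sigma> * (s - t0)))" for s
    define below where "below s \<longleftrightarrow>
      (AE x in lborel. B s * bump L (z + (s - t0) *\<^sub>R drift b \<kappa>) x \<le> u s x)" for s
    \<comment> \<open>steps shorter than \<open>h0\<close> are chained by bisection\<close>
    define P where "P r r' \<longleftrightarrow> (t0 \<le> r \<longrightarrow> below r \<longrightarrow> below r')" for r r'
    have "P t0 t"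
      using t(2)
    proof (induction rule: Bolzano)
      case (local s)
      show ?case
      proof (unfold P_def, intro exI[of _ h0] conjI allI impI pos(2))
        fix r r' assume r: "r \<le> s \<and> s \<le> r' \<and> r' - r < h0" "t0 \<le> r" and br: "below r"
        define h where "h = r' - r"
        have h: "0 \<le> h" "h \<le> h0" using r by (auto simp: h_def)
        have Br: "0 \<le> B r" "B r \<le> e"
          using A pos(1) r e by (auto simp: B_def)
        have "B r' \<le> B r * (1 + \<sigma> * h)"
        proof -
          have "e * 1 \<le> e * (1 + \<sigma> * h)" using e h pos(1) by (intro mult_left_mono) auto
          moreover have "A * (1 + \<sigma> * (r' - t0)) \<le> A * (1 + \<sigma> * (r - t0)) * (1 + \<sigma> * h)"
          proof -
            have "0 \<le> (\<sigma> * (r - t0)) * (\<sigma> * h)" using pos(1) r h by simp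
            then have "1 + \<sigma> * (r' - t0) \<le> (1 + \<sigma> * (r - t0)) * (1 + \<sigma> * h)"
              by (simp add: h_def algebra_simps)
            then show ?thesis using A by (simp add: mult.assoc mult_left_mono)
          qed
          moreover have "0 \<le> 1 + \<sigma> * h" using pos(1) h by simp
          ultimately show ?thesis by (auto simp: B_def min_def)
        qed
        moreover have "AE x in lborel. B r * (1 + \<sigma> * h)
            * bump L (z + (r - t0) *\<^sub>R drift b \<kappa> + h *\<^sub>R drift b \<kappa>) x \<le> u (r + h) x"
          using step[OF Br _ h L br[unfolded below_def]] t(1) r by simp
        moreover have "z + (r - t0) *\<^sub>R drift b \<kappa> + h *\<^sub>R drift b \<kappa> = z + (r' - t0) *\<^sub>R drift b \<kappa>"
          by (simp add: h_def algebra_simps)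
        moreover have "r + h = r'" by (simp add: h_def)
        ultimately show "below r'" unfolding below_def
          by (auto elim!: eventually_mono intro: order.trans[OF mult_right_mono])
      qed
    qed (auto simp: P_def)
    moreover have "below t0" using init A(2) by (simp add: below_def B_def)
    ultimately show ?thesis by (simp add: P_def below_def B_def)
  qed
  then show thesis by (rule that[OF e pos(1,3)])
qed

section \<open>Persistence in the moving frame\<close>

text \<open>
  The level \<open>r\<close> is eventually a lower bound for \<open>u\<close> on every ball that moves with the drift.
\<close>

definition persists :: "real \<Rightarrow> bool" where
  "persists r \<longleftrightarrow> (\<forall>M. \<forall>\<^sub>F t in at_top. AE x in lborel. x \<in> ball (t *\<^sub>R drift b \<kappa>) M \<longrightarrow> r \<le> u t x)"

lemma persists_antimono: "persists r \<Longrightarrow> s \<le> r \<Longrightarrow> persists s"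
  unfolding persists_def by (fast elim!: eventually_mono intro: order.trans)

text \<open>
  The width \<open>L\<close> of the initial bump is chosen after the starting time, which is possible since
  positivity on every ball is available at one common time.
\<close>

lemma persists_positive_level:
  assumes "0 < t1" "0 < \<delta>" "0 < \<eta>" "AE x in lborel. x \<in> ball x0 \<delta> \<longrightarrow> \<eta> \<le> u t1 x"
  shows "\<exists>r>0. r < \<theta> \<and> persists r"
proof -
  obtain e \<sigma> L0 where e: "0 < e" "e \<le> \<theta>" and pos: "0 < \<sigma>" "0 < L0"
    and grow: "\<And>A t0 t L z. 0 < A \<Longrightarrow> A \<le> e \<Longrightarrow> 0 < t0 \<Longrightarrow> t0 \<le> t \<Longrightarrow> L0 \<le> L \<Longrightarrow>
        (AE x in lborel. A * bump L z x \<le> u t0 x) \<Longrightarrow>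
        (AE x in lborel. min e (A * (1 + \<sigma> * (t - t0)))
            * bump L (z + (t - t0) *\<^sub>R drift b \<kappa>) x \<le> u t x)"
    by (rule bump_grows) blast
  define c where "c = drift b \<kappa>"
  define t0 where "t0 = t1 + 1"
  have t0: "0 < t0" "t1 < t0" using assms(1) by (auto simp: t0_def)
  have "persists (e / 2)"
    unfolding persists_def
  proof
    fix M
    define L where "L = max L0 (2 * (\<bar>M\<bar> + norm (x0 - t0 *\<^sub>R c)))"
    have L: "L0 \<le> L" "0 < L" "\<bar>M\<bar> + norm (x0 - t0 *\<^sub>R c) \<le> L / 2" using pos by (auto simp: L_def)
    obtain \<eta>1 where \<eta>1: "\<eta>1 > 0" "AE x in lborel. x \<in> ball x0 L \<longrightarrow> \<eta>1 \<le> u t0 x"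
      using positive_on_balls[OF assms t0(2)] by blast
    define A where "A = min e \<eta>1"
    have A: "0 < A" "A \<le> e" "A \<le> \<eta>1" using e \<eta>1 by (auto simp: A_def)
    have init: "AE x in lborel. A * bump L x0 x \<le> u t0 x"
      using \<eta>1(2) u_nonneg[OF t0(1)]
    proof eventually_elim
      case (elim x)
      show ?case
      proof (cases "x \<in> ball x0 L")
        case True
        have "A * bump L x0 x \<le> A" using A by (simp add: mult_left_le)
        moreover have "\<eta>1 \<le> u t0 x" using True elim by blast
        ultimately show ?thesis using A(3) by linarith
      next
        case False
        then have "bump L x0 x = 0" using L(2) by (intro bump_eq_0) (auto simp: dist_norm norm_minus_commute)
        then show ?thesis using elim by simp
      qed
    qed
    show "\<forall>\<^sub>F t in at_top. AE x in lborel. x \<in> ball (t *\<^sub>R drift b \<kappa>) M \<longrightarrow> e / 2 \<le> u t x"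
      using eventually_ge_at_top[of "t0 + e / (A * \<sigma>)"]
    proof eventually_elim
      case (elim t)
      have "0 \<le> e / (A * \<sigma>)" using e A pos by simp
      then have "t0 \<le> t" using elim by simp
      have "e / (A * \<sigma>) \<le> t - t0" using elim by simp
      then have "e \<le> A * (\<sigma> * (t - t0))" using A pos by (simp add: pos_divide_le_eq mult_ac)
      then have "e \<le> A * (1 + \<sigma> * (t - t0))" using A by (simp add: distrib_left)
      then have m: "min e (A * (1 + \<sigma> * (t - t0))) = e" by simp
      from grow[OF A(1,2) t0(1) \<open>t0 \<le> t\<close> L(1) init]
      show ?case unfolding m c_def[symmetric]
      proof eventually_elim
        case (elim x)
        show ?case
        proof
          assume x: "x \<in> ball (t *\<^sub>R c) M"
          have "x - (x0 + (t - t0) *\<^sub>R c) = (x - t *\<^sub>R c) - (x0 - t0 *\<^sub>R c)" by (simp add: algebra_simps)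
          then have "norm (x - (x0 + (t - t0) *\<^sub>R c)) \<le> norm (x - t *\<^sub>R c) + norm (x0 - t0 *\<^sub>R c)"
            by (simp only: norm_triangle_ineq4)
          also have "\<dots> \<le> L / 2" using x L(3) by (auto simp: dist_norm norm_minus_commute)
          finally have "norm (x - (x0 + (t - t0) *\<^sub>R c)) / L \<le> 1 / 2" using L(2) by (simp add: field_simps)
          then have "(norm (x - (x0 + (t - t0) *\<^sub>R c)) / L)\<^sup>2 \<le> (1 / 2)\<^sup>2"
            using L(2) by (intro power_mono) auto
          also have "(1 / 2)\<^sup>2 = (1 / 4 :: real)" by (simp add: power2_eq_square)
          finally have "1 / 2 \<le> bump L (x0 + (t - t0) *\<^sub>R c) x"
            unfolding bump_def by (intro max.coboundedI2) linarith
          then have "e * (1 / 2) \<le> e * bump L (x0 + (t - t0) *\<^sub>R c) x"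
            using e by (intro mult_left_mono) auto
          then show "e / 2 \<le> u t x" using elim by linarith
        qed
      qed
    qed
  qed
  then show ?thesis using e by (intro exI[of _ "e / 2"]) auto
qed

text \<open>Translation invariance makes \<open>G\<close> of a constant constant.\<close>

lemma G_const:
  assumes "0 < r" "r < \<theta>"
  obtains \<gamma> where "\<gamma> < \<kappa> - m" "AE x in lborel. G (\<lambda>_. r) x = \<gamma>"
proof -
  have rE: "(\<lambda>_. r) \<in> E_plus k \<theta>"
    using assms by (intro E_plus_I uniformly_continuous_bounded_space_E[where C = r]
        uniformly_continuous_on_const) auto
  have "AE x in lborel. G (\<lambda>_. r) (x - y) = G (\<lambda>_. r) x" for y
  proof -
    have "shift y (\<lambda>_. r) = (\<lambda>_. r)" by (simp add: shift_def fun_eq_iff)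
    then have "eqE k (shift y (G (\<lambda>_. r))) (G (\<lambda>_. r))"
      using shift_invariant rE unfolding G_shift_invariant_def by metis
    then show ?thesis unfolding shift_def by (rule eqE_imp_AE)
  qed
  from translation_invariant_AE_const[OF space_E_measurable[OF G_space_E[OF rE]] this]
  obtain \<gamma> where \<gamma>: "AE x in lborel. G (\<lambda>_. r) x = \<gamma>" by blast
  have "AE x in lborel. G (\<lambda>_. r) x < \<kappa> - m"
    using const_less assms unfolding G_const_less_def by (blast intro: holds_E_imp_AE)
  with \<gamma> have "AE x in (lborel :: (real ^ 'd) measure). \<gamma> < \<kappa> - m" by eventually_elim simp
  then have "\<gamma> < \<kappa> - m"
    using eventually_happens[of _ "ae_filter (lborel :: (real ^ 'd) measure)"]
    by (auto simp: ae_filter_eq_bot_iff)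
  with \<gamma> show ?thesis using that by blast
qed

end

section \<open>Cutoff constants\<close>

text \<open>Equal to \<open>1\<close> on the ball of radius \<open>N\<close> and to \<open>0\<close> outside the ball of radius \<open>N + 1\<close>.\<close>

definition cutoff :: "real \<Rightarrow> real ^ 'd \<Rightarrow> real" where
  "cutoff N x = max 0 (min 1 (N + 1 - norm x))"

lemma cutoff_bounds [simp]: "0 \<le> cutoff N x" "cutoff N x \<le> 1"
  by (auto simp: cutoff_def)

lemma cutoff_eq_1: "norm x \<le> N \<Longrightarrow> cutoff N x = 1"
  and cutoff_eq_0: "N + 1 \<le> norm x \<Longrightarrow> cutoff N x = 0"
  by (auto simp: cutoff_def)

lemma cutoff_measurable [measurable]: "cutoff N \<in> borel_measurable borel"
  unfolding cutoff_def by measurable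

lemma cutoff_E_plus:
  fixes z :: "real ^ 'd"
  assumes "0 \<le> r" "r \<le> \<theta>" shows "(\<lambda>x. r * cutoff N (x - z)) \<in> E_plus k \<theta>"
proof (rule E_plus_I)
  have lip: "\<bar>cutoff N (x - z) - cutoff N (y - z)\<bar> \<le> 1 * norm (x - y)" for x y :: "real ^ 'd"
    using norm_triangle_ineq3[of "x - z" "y - z"] unfolding cutoff_def
    by (auto simp: abs_le_iff max_def min_def)
  have "(\<lambda>x. cutoff N (x - z)) \<in> space_E k"
    by (rule lipschitz_bounded_space_E[OF lip, where C = 1]) (simp add: abs_le_iff order.trans[OF _ cutoff_bounds(1)])
  from space_E_lin[OF this this, of r 0] show "(\<lambda>x. r * cutoff N (x - z)) \<in> space_E k" by simp
  show "0 \<le> r * cutoff N (x - z)" for x using assms by simp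
  show "r * cutoff N (x - z) \<le> \<theta>" for x
    using assms mult_left_le[of "cutoff N (x - z)" r] by simp
qed

lemma cutoff_loc_unif_conv: "loc_unif_conv k (\<lambda>n x. r * cutoff (real n) x) (\<lambda>x. r)"
  unfolding loc_unif_conv_def
proof (intro allI impI)
  fix K :: "(real ^ 'd) set" and e :: real assume "compact K" "e > 0"
  then obtain B where B: "\<And>x. x \<in> K \<Longrightarrow> norm x \<le> B"
    using compact_imp_bounded bounded_iff by metis
  show "\<forall>\<^sub>F n in sequentially. holds_E k (\<lambda>x. x \<in> K \<longrightarrow> dist (r * cutoff (real n) x) r < e)"
    using eventually_ge_at_top[of "nat \<lceil>B\<rceil>"]
  proof eventually_elim
    case (elim n)
    show ?case
    proof (intro holds_E_I impI)
      fix x assume "x \<in> K"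
      then have "norm x \<le> real n" using B[of x] elim by linarith
      then show "dist (r * cutoff (real n) x) r < e" using \<open>e > 0\<close> by (simp add: cutoff_eq_1)
    qed
  qed
qed

section \<open>Raising the persisting level\<close>

context growing_flow
begin

lemma conv_cutoff_lower_bound:
  assumes "1 \<le> R" "norm x + R \<le> N"
  shows "1 - (LINT y|lborel. norm y * b y * indicator {y. R < norm y} y) \<le> conv b (cutoff N) x"
proof -
  have far: "integrable lborel (\<lambda>y. norm y * b y * indicator {y. R < norm y} y)"
    by (rule integrable_real_mult_indicator[OF _ kernel_facts(5)]) simp
  have "(LINT y|lborel. b y - norm y * b y * indicator {y. R < norm y} y)
      \<le> (LINT y|lborel. b y * cutoff N (x - y))"
  proof (rule integral_mono_AE)
    show "integrable lborel (\<lambda>y. b y * cutoff N (x - y))"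
      by (rule integrable_kernel_mult[OF kernel_facts(1), where C = 1]) auto
    show "AE y in lborel. b y - norm y * b y * indicator {y. R < norm y} y \<le> b y * cutoff N (x - y)"
      using kernel_facts(2)
    proof eventually_elim
      case (elim y)
      show ?case
      proof (cases "R < norm y")
        case True
        then have "1 * b y \<le> norm y * b y" using elim assms(1) by (intro mult_right_mono) auto
        moreover have "0 \<le> b y * cutoff N (x - y)" using elim by simp
        ultimately show ?thesis using True by simp
      next
        case False
        then have "norm (x - y) \<le> N" using norm_triangle_ineq4[of x y] assms(2) by linarith
        then show ?thesis using False by (simp add: cutoff_eq_1)
      qed
    qed
  qed (use kernel_facts(1) far in auto)
  then show ?thesis
    using kernel_facts(1,3) far by (simp add: conv_commute kernel_facts(4))
qed

text \<open>
  If \<open>r\<close> persists, then the solution is eventually above wide cutoffs of the constant \<open>r\<close> that move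
  with the drift. By the continuity of convolution and \<open>G\<close> with respect to locally uniform convergence such a cutoff grows,
  far inside its support, almost like the constant \<open>r\<close>, hence at a positive rate if \<open>r\<close> is close to
  \<open>r0\<close>, since \<open>G r0 < \<kappa> - m\<close>. The resulting factor \<open>1 + \<omega>\<close> does not depend on \<open>r\<close>.
\<close>

lemma persists_gain:
  assumes r0: "0 < r0" "r0 < \<theta>"
  shows "\<exists>\<zeta>>0. \<exists>\<omega>>0. \<forall>r. 0 < r \<and> r0 - \<zeta> \<le> r \<and> r \<le> r0 \<and> persists r \<longrightarrow> persists (r * (1 + \<omega>))"
proof -
  obtain \<gamma> where \<gamma>: "\<gamma> < \<kappa> - m" "AE x in lborel. G (\<lambda>_. r0) x = \<gamma>" using G_const[OF r0] .
  obtain l where l: "l > 0" "\<And>v w e. v \<in> E_plus k \<theta> \<Longrightarrow> w \<in> E_plus k \<theta> \<Longrightarrow> (\<And>x. \<bar>v x - w x\<bar> \<le> e) \<Longrightarrow>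
    AE x in lborel. \<bar>G v x - G w x\<bar> \<le> l * e" by (rule G_AE_lipschitz) blast
  define gap where "gap = \<kappa> - m - \<gamma>"
  have gap: "0 < gap" using \<gamma>(1) by (simp add: gap_def)
  define \<Lambda> where "\<Lambda> = m + p"
  have \<Lambda>: "0 < \<Lambda>" using m_pos p_ge_1 by (simp add: \<Lambda>_def)
  define h where "h = min 1 (gap / (8 * (\<Lambda> * (\<Lambda> + gap / 4))))"
  have h: "0 < h" "h \<le> 1" using gap \<Lambda> by (auto simp: h_def)
  have "h \<le> gap / (8 * (\<Lambda> * (\<Lambda> + gap / 4)))" by (simp add: h_def)
  moreover have "0 < 8 * (\<Lambda> * (\<Lambda> + gap / 4))" using gap \<Lambda> by simp
  ultimately have "h * (8 * (\<Lambda> * (\<Lambda> + gap / 4))) \<le> gap" by (simp only: pos_le_divide_eq)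
  then have h3: "h * (\<Lambda> * (\<Lambda> + gap / 4)) \<le> gap / 8" by simp
  define \<omega> where "\<omega> = h * (gap / 8)"
  define \<zeta> where "\<zeta> = gap / (4 * l)"
  have \<omega>: "0 < \<omega>" and \<zeta>: "0 < \<zeta>" "l * \<zeta> = gap / 4" using h gap l by (auto simp: \<omega>_def \<zeta>_def)
  have rate: "1 + \<omega> \<le> exp (- (m + p) * h) * (1 + h * (\<Lambda> + gap / 4))"
  proof -
    have "h * (h * (\<Lambda> * (\<Lambda> + gap / 4))) \<le> h * (gap / 8)" using h3 h(1) by (intro mult_left_mono) auto
    then have "1 + \<omega> \<le> (1 - \<Lambda> * h) * (1 + h * (\<Lambda> + gap / 4))"
      by (simp add: \<omega>_def algebra_simps)
    also have "\<dots> \<le> exp (- (m + p) * h) * (1 + h * (\<Lambda> + gap / 4))"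
    proof (rule mult_right_mono)
      show "1 - \<Lambda> * h \<le> exp (- (m + p) * h)"
        using exp_ge_add_one_self[of "- (m + p) * h"]
        by (simp only: \<Lambda>_def minus_mult_left[symmetric] add_uminus_conv_diff)
      show "0 \<le> 1 + h * (\<Lambda> + gap / 4)" using h gap \<Lambda> by simp
    qed
    finally show ?thesis .
  qed
  define c where "c = drift b \<kappa>"
  have "persists (r * (1 + \<omega>))" if r: "0 < r" "r0 - \<zeta> \<le> r" "r \<le> r0" and pers: "persists r" for r
    unfolding persists_def
  proof
    fix M
    define M1 where "M1 = \<bar>M\<bar> + norm c"
    have M1: "0 \<le> M1" by (simp add: M1_def)
    have "0 < gap / (4 * \<kappa>)" using gap \<kappa>_pos by simp
    from kernel_tail_small[OF kernel_facts(5) this, of 1] obtain R where R: "1 \<le> R"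
      "\<bar>LINT y|lborel. norm y * b y * indicator {y. R < norm y} y\<bar> < gap / (4 * \<kappa>)" by blast
    have r0E: "(\<lambda>_. r0) \<in> E_plus k \<theta>"
      using r0 by (intro E_plus_I uniformly_continuous_bounded_space_E[where C = r0]
          uniformly_continuous_on_const) auto
    have "loc_unif_conv k (\<lambda>n. G (\<lambda>x. r0 * cutoff (real n) x)) (G (\<lambda>_. r0))"
    proof (rule loc_continuous[unfolded G_loc_continuous_def, rule_format])
      show "(\<lambda>x :: real ^ 'd. r0 * cutoff (real n) x) \<in> E_plus k \<theta>" for n
        using cutoff_E_plus[of r0 \<theta> "real n" "0 :: real ^ 'd" k] r0 by simp
    qed (fact r0E cutoff_loc_unif_conv)+
    then have "\<forall>\<^sub>F n in sequentially. holds_E k (\<lambda>x. x \<in> cball 0 M1 \<longrightarrow>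
        dist (G (\<lambda>x. r0 * cutoff (real n) x) x) (G (\<lambda>_. r0) x) < gap / 4)"
      using gap unfolding loc_unif_conv_def by (meson compact_cball divide_pos_pos zero_less_numeral)
    with eventually_ge_at_top[of "nat \<lceil>M1 + R\<rceil>"]
    have "\<forall>\<^sub>F n in sequentially. M1 + R \<le> real n \<and> holds_E k (\<lambda>x. x \<in> cball 0 M1 \<longrightarrow>
        dist (G (\<lambda>x. r0 * cutoff (real n) x) x) (G (\<lambda>_. r0) x) < gap / 4)"
      by eventually_elim linarith
    then obtain n where n: "M1 + R \<le> real n" "holds_E k (\<lambda>x. x \<in> cball 0 M1 \<longrightarrow>
        dist (G (\<lambda>x. r0 * cutoff (real n) x) x) (G (\<lambda>_. r0) x) < gap / 4)"
      using eventually_happens'[OF sequentially_bot] by blast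
    define N where "N = real n"
    define w where "w x = r * cutoff N x" for x :: "real ^ 'd"
    have wE: "w \<in> E_plus k \<theta>"
      using r r0 cutoff_E_plus[of r \<theta> N "0 :: real ^ 'd" k] by (simp add: w_def[abs_def])
    have wm: "w \<in> borel_measurable borel" unfolding w_def by measurable
    have w1: "w x = r" if "norm x \<le> M1" for x
      using that n(1) R(1) by (simp add: w_def N_def cutoff_eq_1)
    have "\<bar>w x - r0 * cutoff N x\<bar> \<le> r0 - r" for x
    proof -
      have "\<bar>w x - r0 * cutoff N x\<bar> = (r0 - r) * cutoff N x"
        using r by (simp add: w_def left_diff_distrib[symmetric] abs_mult)
      also have "\<dots> \<le> r0 - r" using r by (intro mult_left_le) auto
      finally show ?thesis .
    qed
    from l(2)[OF wE _ this] cutoff_E_plus[of r0 \<theta> N "0 :: real ^ 'd" k] r0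
    have "AE x in lborel. \<bar>G w x - G (\<lambda>x. r0 * cutoff N x) x\<bar> \<le> l * (r0 - r)" by simp
    with holds_E_imp_AE[OF n(2)] \<gamma>(2)
    have Gw: "AE x in lborel. norm x \<le> M1 \<longrightarrow> G w x \<le> \<gamma> + gap / 2"
    proof eventually_elim
      case (elim x)
      have "l * (r0 - r) \<le> l * \<zeta>" using r l(1) by (intro mult_left_mono) auto
      show ?case
      proof
        assume "norm x \<le> M1"
        then have "\<bar>G (\<lambda>x. r0 * cutoff N x) x - \<gamma>\<bar> < gap / 4"
          using elim(1,2) by (simp add: N_def dist_real_def)
        then show "G w x \<le> \<gamma> + gap / 2"
          using elim(3) \<open>l * (r0 - r) \<le> l * \<zeta>\<close> unfolding \<zeta>(2) by linarith
      qed
    qed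
    have w_growth: "AE x in lborel. norm x \<le> M1 \<longrightarrow>
        r * (\<Lambda> + gap / 4) \<le> reaction b \<kappa> G w x + p * w x"
      using Gw
    proof eventually_elim
      case (elim x)
      show ?case
      proof
        assume x: "norm x \<le> M1"
        have "1 - gap / (4 * \<kappa>) \<le> conv b (cutoff N) x"
          using conv_cutoff_lower_bound[OF R(1), of x N] x n(1) R(2) by (simp add: N_def)
        then have "\<kappa> * (1 - gap / (4 * \<kappa>)) \<le> \<kappa> * conv b (cutoff N) x"
          using \<kappa>_pos by (intro mult_left_mono) auto
        moreover have "\<kappa> * (1 - gap / (4 * \<kappa>)) = \<kappa> - gap / 4" using \<kappa>_pos by (simp add: field_simps)
        ultimately have "\<kappa> - gap / 4 - (\<gamma> + gap / 2) + p \<le> \<kappa> * conv b (cutoff N) x - G w x + p"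
          using elim x by auto
        moreover have eq: "\<Lambda> + gap / 4 = \<kappa> - gap / 4 - (\<gamma> + gap / 2) + p"
          by (simp add: \<Lambda>_def gap_def field_simps)
        ultimately have "r * (\<Lambda> + gap / 4) \<le> r * (\<kappa> * conv b (cutoff N) x - G w x + p)"
          using r(1) unfolding eq by (intro mult_left_mono) auto
        also have "\<dots> = reaction b \<kappa> G w x + p * w x"
        proof -
          have "conv b w x = r * conv b (cutoff N) x" unfolding w_def by (rule conv_cmult)
          then show ?thesis by (simp add: reaction_def w1[OF x] algebra_simps)
        qed
        finally show "r * (\<Lambda> + gap / 4) \<le> reaction b \<kappa> G w x + p * w x" .
      qed
    qed
    define Q where "Q t \<longleftrightarrow> (AE x in lborel. x \<in> ball (t *\<^sub>R c) (N + 2 + norm c) \<longrightarrow> r \<le> u t x)" for t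
    obtain T where T: "\<And>t. T \<le> t \<Longrightarrow> Q t"
      using pers unfolding persists_def Q_def c_def eventually_at_top_linorder by blast
    define T' where "T' = max T 1"
    have step: "AE x in lborel. x \<in> ball ((t + h) *\<^sub>R c) M \<longrightarrow> r * (1 + \<omega>) \<le> u (t + h) x"
      if t: "T' \<le> t" for t
    proof -
      have t0: "0 < t" "T \<le> t" using t by (auto simp: T'_def)
      define v where "v = shift (t *\<^sub>R c) w"
      let ?S = "cball (t *\<^sub>R c) M1"
      have vE: "v \<in> E_plus k \<theta>"
        using r r0 cutoff_E_plus[of r \<theta> N "t *\<^sub>R c" k] by (simp add: v_def w_def shift_def[abs_def])
      have Gv: "AE x in lborel. G w (x - t *\<^sub>R c) = G v x"
        using shift_invariant wE unfolding G_shift_invariant_def v_def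
        by (auto dest!: bspec[of _ _ w] spec[of _ "t *\<^sub>R c"] eqE_imp_AE simp: shift_def[of _ "G w"])
      have v_growth: "AE x in lborel. x \<in> ?S \<longrightarrow> r * (\<Lambda> + gap / 4) \<le> reaction b \<kappa> G v x + p * v x"
        using AE_translate[OF w_growth, of "t *\<^sub>R c"] Gv
      proof eventually_elim
        case (elim x)
        have "conv b v x = conv b w (x - t *\<^sub>R c)" unfolding v_def
          by (rule conv_shift[OF kernel_facts(4) wm])
        then show ?case using elim
          by (auto simp: reaction_def v_def shift_def dist_norm norm_minus_commute)
      qed
      have "AE x in lborel. x \<in> ?S \<longrightarrow>
          u (t + h) x \<ge> exp (- (m + p) * h) * (u t x + h * (r * (\<Lambda> + gap / 4)))"
      proof (rule growth[OF t0(1) less_imp_le[OF h(1)]])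
        fix s assume s: "t \<le> s" "s \<le> t + h"
        show "\<exists>v\<in>E_plus k \<theta>. (AE x in lborel. v x \<le> u s x) \<and> (AE x in lborel. x \<in> ?S \<longrightarrow>
           exp (- (m + p) * (s - t)) * (r * (\<Lambda> + gap / 4)) \<le> reaction b \<kappa> G v x + p * v x)"
        proof (intro bexI[OF _ vE] conjI)
          have "Q s" using T[of s] s t0 by simp
          then have "AE x in lborel. x \<in> ball (s *\<^sub>R c) (N + 2 + norm c) \<longrightarrow> r \<le> u s x"
            by (simp add: Q_def)
          moreover have "AE x in lborel. 0 \<le> u s x" using u_nonneg[of s] s t0 by simp
          ultimately show "AE x in lborel. v x \<le> u s x"
          proof eventually_elim
            case (elim x)
            show ?case
            proof (cases "norm (x - t *\<^sub>R c) < N + 1")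
              case True
              have "norm ((s - t) *\<^sub>R c) \<le> 1 * norm c"
                unfolding norm_scaleR using s h by (intro mult_right_mono) auto
              moreover have "x - s *\<^sub>R c = (x - t *\<^sub>R c) - (s - t) *\<^sub>R c" by (simp add: algebra_simps)
              then have "norm (x - s *\<^sub>R c) \<le> norm (x - t *\<^sub>R c) + norm ((s - t) *\<^sub>R c)"
                by (simp only: norm_triangle_ineq4)
              ultimately have "norm (x - s *\<^sub>R c) < N + 2 + norm c" using True by simp
              then have "r \<le> u s x" using elim by (auto simp: dist_norm norm_minus_commute)
              moreover have "v x \<le> r" using r by (simp add: v_def shift_def w_def mult_left_le)
              ultimately show ?thesis by simp
            next
              case False
              then show ?thesis using elim by (simp add: v_def shift_def w_def cutoff_eq_0)
            qed
          qed
          show "AE x in lborel. x \<in> ?S \<longrightarrow>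
           exp (- (m + p) * (s - t)) * (r * (\<Lambda> + gap / 4)) \<le> reaction b \<kappa> G v x + p * v x"
            using v_growth
          proof eventually_elim
            case (elim x)
            have "0 \<le> (m + p) * (s - t)" using s \<Lambda> by (auto simp: \<Lambda>_def)
            then have "- (m + p) * (s - t) \<le> 0" by (simp only: minus_mult_left[symmetric] neg_le_0_iff_le)
            then have "exp (- (m + p) * (s - t)) \<le> 1" by (simp only: exp_le_one_iff)
            then have "exp (- (m + p) * (s - t)) * (r * (\<Lambda> + gap / 4)) \<le> 1 * (r * (\<Lambda> + gap / 4))"
              using r \<Lambda> gap by (intro mult_right_mono) auto
            then show ?case using elim by linarith
          qed
        qed
      qed
      moreover have "Q t" using T t0 by simp
      ultimately show ?thesis unfolding Q_def
      proof eventually_elim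
        case (elim x)
        show ?case
        proof
          assume "x \<in> ball ((t + h) *\<^sub>R c) M"
          then have "norm (x - (t + h) *\<^sub>R c) \<le> \<bar>M\<bar>" by (auto simp: dist_norm norm_minus_commute)
          moreover have "x - t *\<^sub>R c = (x - (t + h) *\<^sub>R c) + h *\<^sub>R c" by (simp add: algebra_simps)
          then have "norm (x - t *\<^sub>R c) \<le> norm (x - (t + h) *\<^sub>R c) + norm (h *\<^sub>R c)"
            by (simp only: norm_triangle_ineq)
          moreover have "norm (h *\<^sub>R c) \<le> 1 * norm c"
            unfolding norm_scaleR using h by (intro mult_right_mono) auto
          ultimately have n1: "norm (x - t *\<^sub>R c) \<le> M1" by (simp add: M1_def)
          moreover have "M1 < N + 2 + norm c"
            using n(1) R(1) norm_ge_zero[of c] unfolding N_def by linarith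
          ultimately have "r \<le> u t x" using elim by (auto simp: dist_norm norm_minus_commute)
          then have "r * (1 + h * (\<Lambda> + gap / 4)) \<le> u t x + h * (r * (\<Lambda> + gap / 4))"
            by (simp add: algebra_simps)
          then have "exp (- (m + p) * h) * (r * (1 + h * (\<Lambda> + gap / 4)))
             \<le> exp (- (m + p) * h) * (u t x + h * (r * (\<Lambda> + gap / 4)))"
            by (intro mult_left_mono) auto
          also have "\<dots> \<le> u (t + h) x"
            using elim n1 by (auto simp: dist_norm norm_minus_commute)
          finally have "exp (- (m + p) * h) * (r * (1 + h * (\<Lambda> + gap / 4))) \<le> u (t + h) x" .
          moreover have "r * (1 + \<omega>) \<le> r * (exp (- (m + p) * h) * (1 + h * (\<Lambda> + gap / 4)))"
            using rate r(1) by (intro mult_left_mono) auto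
          moreover have "\<dots> = exp (- (m + p) * h) * (r * (1 + h * (\<Lambda> + gap / 4)))"
            by (rule mult.left_commute)
          ultimately show "r * (1 + \<omega>) \<le> u (t + h) x" by linarith
        qed
      qed
    qed
    show "\<forall>\<^sub>F t in at_top. AE x in lborel. x \<in> ball (t *\<^sub>R drift b \<kappa>) M \<longrightarrow> r * (1 + \<omega>) \<le> u t x"
      using eventually_ge_at_top[of "T' + h"]
    proof eventually_elim
      case (elim t)
      then show ?case using step[of "t - h"] by (simp add: c_def)
    qed
  qed
  then show ?thesis using \<omega> \<zeta>(1) by blast
qed

text \<open>The supremum of the persisting levels is \<open>\<theta>\<close>, as any smaller one could be raised.\<close>

lemma persists_below_\<theta>:
  assumes "0 < t1" "0 < \<delta>" "0 < \<eta>" "AE x in lborel. x \<in> ball x0 \<delta> \<longrightarrow> \<eta> \<le> u t1 x" "r < \<theta>"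
  shows "persists r"
proof -
  let ?P = "{s. 0 < s \<and> s < \<theta> \<and> persists s}"
  have ne: "?P \<noteq> {}" using persists_positive_level[OF assms(1-4)] by auto
  have bdd: "bdd_above ?P" by (intro bdd_aboveI[of _ \<theta>]) auto
  have "\<theta> \<le> Sup ?P"
  proof (rule ccontr)
    define r0 where "r0 = Sup ?P"
    assume "\<not> \<theta> \<le> Sup ?P"
    then have "r0 < \<theta>" by (simp add: r0_def)
    have up: "s \<le> r0" if "s \<in> ?P" for s unfolding r0_def using that bdd by (rule cSup_upper)
    with ne have "0 < r0" by force
    obtain \<zeta> \<omega> where gain: "\<zeta> > 0" "\<omega> > 0"
      "\<And>r. 0 < r \<Longrightarrow> r0 - \<zeta> \<le> r \<Longrightarrow> r \<le> r0 \<Longrightarrow> persists r \<Longrightarrow> persists (r * (1 + \<omega>))"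
      using persists_gain[OF \<open>0 < r0\<close> \<open>r0 < \<theta>\<close>] by blast
    have "r0 / (1 + \<omega>) < r0" using \<open>0 < r0\<close> gain(2) by (simp add: field_simps)
    then have "max (r0 - \<zeta>) (r0 / (1 + \<omega>)) < Sup ?P" using gain(1) by (simp add: r0_def[symmetric])
    then obtain s where s: "s \<in> ?P" "max (r0 - \<zeta>) (r0 / (1 + \<omega>)) < s"
      using less_cSup_iff[OF ne bdd] by blast
    have "persists (s * (1 + \<omega>))" using gain(3)[of s] s up[OF s(1)] by auto
    moreover have "r0 < s * (1 + \<omega>)" using s(2) gain(2) by (simp add: pos_divide_less_eq)
    moreover define s' where "s' = min (s * (1 + \<omega>)) ((r0 + \<theta>) / 2)"
    ultimately have "persists s'" "r0 < s'" "s' < \<theta>"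
      using \<open>r0 < \<theta>\<close> by (auto intro: persists_antimono simp: min_less_iff_disj)
    then show False using up[of s'] \<open>0 < r0\<close> by auto
  qed
  then have "r < Sup ?P" using assms(5) by simp
  then obtain s where "s \<in> ?P" "r < s" using less_cSup_iff[OF ne bdd] by blast
  then show ?thesis by (auto intro: persists_antimono)
qed

end

section \<open>The essential infimum over a compact set\<close>

lemma ess_inf_on_ge:
  fixes f :: "real ^ 'd \<Rightarrow> real"
  assumes f: "f \<in> borel_measurable borel" "k \<noteq> Linf \<Longrightarrow> continuous_on UNIV f"
    and low: "AE x in lborel. x \<in> ball 0 M \<longrightarrow> r \<le> f x"
    and K: "K \<in> sets borel" "K \<subseteq> ball 0 M"
  shows "ereal r \<le> ess_inf_on k K f"
proof (cases "k = Linf")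
  case True
  have "esssup (restrict_space lborel K) (\<lambda>x. ereal (- f x)) \<le> ereal (- r)"
  proof (rule esssup_I)
    have "(\<lambda>x. ereal (- f x)) \<in> borel_measurable lborel" using f(1) by simp
    then show "(\<lambda>x. ereal (- f x)) \<in> borel_measurable (restrict_space lborel K)"
      by (rule measurable_restrict_space1)
    show "AE x in restrict_space lborel K. ereal (- f x) \<le> ereal (- r)"
      using low K by (subst AE_restrict_space_iff) (auto elim!: eventually_mono)
  qed
  then show ?thesis using True
    by (cases "esssup (restrict_space lborel K) (\<lambda>x. ereal (- f x))") auto
next
  case False
  have "r \<le> f x" if "x \<in> K" for x
  proof -
    have "0 \<le> f x - r"
    proof (rule AE_nonneg_open_imp[of "ball 0 M"])
      show "continuous_on UNIV (\<lambda>x. f x - r)" by (intro continuous_intros f(2) False)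
    qed (use low K that in auto)
    then show ?thesis by simp
  qed
  then have "ereal r \<le> (INF x\<in>K. ereal (f x))" by (intro INF_greatest) simp
  then show ?thesis using False by (cases k) auto
qed

lemma ess_inf_on_le:
  fixes f :: "real ^ 'd \<Rightarrow> real"
  assumes "holds_E k (\<lambda>x. f x \<le> r)" "nonnegligible k K" "K \<in> sets borel"
  shows "ess_inf_on k K f \<le> ereal r"
proof (cases "k = Linf")
  case True
  let ?R = "restrict_space lborel K"
  have "ereal (- r) \<le> esssup ?R (\<lambda>x. ereal (- f x))"
  proof (rule ccontr)
    assume *: "\<not> ereal (- r) \<le> esssup ?R (\<lambda>x. ereal (- f x))"
    have "AE x in ?R. f x \<le> r"
      using assms(1,3) True by (subst AE_restrict_space_iff) auto
    with esssup_AE[of "\<lambda>x. ereal (- f x)" ?R] have "AE x in ?R. False"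
    proof eventually_elim
      case (elim x)
      then have "ereal (- f x) < ereal (- r)" using * by (meson not_le order.strict_trans1)
      then show ?case using elim by simp
    qed
    then have "emeasure ?R (space ?R) = 0" by (simp add: ae_filter_eq_bot_iff[symmetric] trivial_limit_def)
    then have "emeasure lborel K = 0" using assms(3) by (simp add: emeasure_restrict_space space_restrict_space)
    then show False using assms(2) True by simp
  qed
  then show ?thesis using True by (cases "esssup ?R (\<lambda>x. ereal (- f x))") auto
next
  case False
  then obtain x where x: "x \<in> K" using assms(2) by (cases k) auto
  have "f x \<le> r" using assms(1) False by (cases k) auto
  then have "(INF x\<in>K. ereal (f x)) \<le> ereal r" using x by (auto intro: INF_lower2)
  then show ?thesis using False by (cases k) auto
qed

lemma ereal_le_of_dense_below:
  assumes "\<And>r. r < c \<Longrightarrow> ereal r \<le> X" shows "ereal c \<le> X"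
proof (rule ccontr)
  assume "\<not> ereal c \<le> X"
  then have "X < ereal c" by simp
  then obtain r where "X < ereal r" "ereal r < ereal c" using ereal_dense2[of X "ereal c"] by blast
  then show False using assms[of r] by auto
qed

section \<open>Persistence of the solution\<close>

text \<open>
  The equation holds only for positive times, so the lower bound for the initial value is
  transferred to a positive time by continuity at \<open>0\<close>.
\<close>

lemma initial_positive_ball:
  fixes u :: "real \<Rightarrow> real ^ 'd \<Rightarrow> real"
  assumes sol: "classical_solution k m a \<kappa> G u0 u" and u0: "u0 \<in> E_plus k \<theta>" "not_identically_zero k u0"
  obtains t1 \<delta> \<eta> x0 where "0 < t1" "0 < \<delta>" "0 < \<eta>" "AE x in lborel. x \<in> ball x0 \<delta> \<longrightarrow> \<eta> \<le> u t1 x"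
proof -
  have "\<exists>\<delta>>0. \<exists>\<eta>>0. \<exists>x0. AE x in lborel. x \<in> ball x0 \<delta> \<longrightarrow> \<eta> \<le> u0 x"
  proof (cases "k = Linf")
    case True
    then show ?thesis using u0(2) by auto
  next
    case False
    then obtain x0 where "u0 x0 \<noteq> 0" using u0(2) by (cases k) auto
    moreover have "0 \<le> u0 x0" using u0(1) False by (cases k) (auto simp: E_plus_def leE_def)
    ultimately have pos: "0 < u0 x0" by simp
    have "continuous_on UNIV u0" using u0(1) False by (intro space_E_continuous) (auto simp: E_plus_def)
    then have "isCont u0 x0" by (simp add: continuous_on_eq_continuous_at)
    then obtain \<delta> where \<delta>: "\<delta> > 0" "\<And>x. dist x x0 < \<delta> \<Longrightarrow> dist (u0 x) (u0 x0) < u0 x0 / 2"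
      using pos unfolding continuous_at_eps_delta by (meson half_gt_zero)
    have "u0 x0 / 2 \<le> u0 x" if "x \<in> ball x0 \<delta>" for x
    proof -
      have "\<bar>u0 x0 - u0 x\<bar> < u0 x0 / 2"
        using \<delta>(2)[of x] that by (simp add: dist_commute dist_real_def)
      then show ?thesis by linarith
    qed
    then show ?thesis using \<delta>(1) pos
      by (intro exI[of _ \<delta>] conjI exI[of _ "u0 x0 / 2"] exI[of _ x0]) auto
  qed
  then obtain \<delta> \<eta> x0 where \<delta>: "\<delta> > 0" "\<eta> > 0" "AE x in lborel. x \<in> ball x0 \<delta> \<longrightarrow> \<eta> \<le> u0 x" by blast
  have uE: "\<And>t. t \<ge> 0 \<Longrightarrow> u t \<in> space_E k" and init: "eqE k (u 0) u0"
    and cont: "((\<lambda>s. norm_E k (\<lambda>x. u s x - u 0 x)) \<longlongrightarrow> 0) (at 0 within {0..})"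
    using sol unfolding classical_solution_def by auto
  have "at (0::real) within {0..} = at_right 0" by (rule at_within_Ici_at_right)
  then have "eventually (\<lambda>s. norm_E k (\<lambda>x. u s x - u 0 x) < \<eta> / 2) (at_right 0)"
    using cont \<delta>(2) by (auto dest!: order_tendstoD(2)[where a = "\<eta> / 2"])
  then obtain b where b: "b > 0" "\<And>s. 0 < s \<Longrightarrow> s < b \<Longrightarrow> norm_E k (\<lambda>x. u s x - u 0 x) < \<eta> / 2"
    unfolding eventually_at_right_field by auto
  define t1 where "t1 = b / 2"
  have t1: "0 < t1" "norm_E k (\<lambda>x. u t1 x - u 0 x) < \<eta> / 2" using b(1) b(2)[of t1] by (auto simp: t1_def)
  have "AE x in lborel. \<bar>u t1 x - u 0 x\<bar> \<le> norm_E k (\<lambda>x. u t1 x - u 0 x)"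
    using uE t1(1) by (intro norm_E_bound space_E_diff) auto
  with eqE_imp_AE[OF init] \<delta>(3) have "AE x in lborel. x \<in> ball x0 \<delta> \<longrightarrow> \<eta> / 2 \<le> u t1 x"
  proof eventually_elim
    case (elim x)
    then show ?case using t1(2) by (auto simp: abs_le_iff)
  qed
  then show ?thesis using that[of t1 \<delta> "\<eta> / 2" x0] t1(1) \<delta>(1,2) by simp
qed

text \<open>
  A solution grows at least as prescribed by any equation whose right-hand side is smaller on
  \<open>E_plus k \<theta>'\<close>: monotonicity of the right-hand side after adding \<open>p u\<close> allows to replace \<open>u\<close> by any
  smaller function first.
\<close>

lemma solution_growing_flow:
  fixes u :: "real \<Rightarrow> real ^ 'd \<Rightarrow> real"
  assumes "0 < m" "0 < \<theta>'" "\<theta>' \<le> \<theta>"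
    and cond: "basic_conditions k m a \<kappa> G \<theta>"
    and b: "prob_kernel b" "maps_E k G'" "all_conditions k m b \<kappa>' G' \<theta>'"
    and comp: "\<And>w. w \<in> E_plus k \<theta>' \<Longrightarrow> leE k (reaction b \<kappa>' G' w) (reaction a \<kappa> G w)"
    and sol: "classical_solution k m a \<kappa> G u0 u" and uE: "\<And>t. t \<ge> 0 \<Longrightarrow> u t \<in> E_plus k \<theta>"
  shows "\<exists>p. growing_flow k m \<kappa>' \<theta>' p b G' u"
proof -
  from cond obtain p0 where p0: "p0 \<ge> 0" "\<And>v w. v \<in> E_plus k \<theta> \<Longrightarrow> w \<in> E_plus k \<theta> \<Longrightarrow> leE k v w \<Longrightarrow>
        leE k (\<lambda>x. reaction a \<kappa> G v x + p0 * v x) (\<lambda>x. reaction a \<kappa> G w x + p0 * w x)"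
    unfolding basic_conditions_def quasi_monotone_def by blast
  define p where "p = max 1 p0"
  have p: "1 \<le> p" "p0 \<le> p" by (auto simp: p_def)
  obtain u' where u': "\<And>t. t > 0 \<Longrightarrow> u' t \<in> space_E k"
    "\<And>t e. t > 0 \<Longrightarrow> e > 0 \<Longrightarrow> \<exists>d>0. \<forall>s. \<bar>s - t\<bar> < d \<longrightarrow>
           (AE x in lborel. \<bar>u s x - u t x - (s - t) * u' t x\<bar> \<le> e * \<bar>s - t\<bar>)"
    "\<And>t. t > 0 \<Longrightarrow> AE x in lborel. u' t x = reaction a \<kappa> G (u t) x - m * u t x"
    using classical_solution_AE_derivative[OF sol] by blast
  have "growing_flow k m \<kappa>' \<theta>' p b G' u"
  proof
    show "0 < m" "0 < \<theta>'" "1 \<le> p" "prob_kernel b" "maps_E k G'" using assms p by auto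
    show "m < \<kappa>'" "G_range k m \<kappa>' G' \<theta>'" "G_lipschitz k G' \<theta>'" "positive_near_0 b"
      "G_loc_continuous k G' \<theta>'" "G_shift_invariant k G' \<theta>'" "G_const_less k m \<kappa>' G' \<theta>'"
      "finite_first_moment b"
      using b(3) unfolding all_conditions_def basic_conditions_def by auto
    show "AE x in lborel. 0 \<le> u t x" if "0 < t" for t
      using uE[of t] that by (auto simp: E_plus_def dest: leE_imp_AE)
  next
    fix t h :: real and S and g :: "real ^ 'd \<Rightarrow> real"
    assume th: "0 < t" "0 \<le> h"
      and hyp: "\<And>s. t \<le> s \<Longrightarrow> s \<le> t + h \<Longrightarrow> \<exists>v \<in> E_plus k \<theta>'. (AE x in lborel. v x \<le> u s x) \<and>
         (AE x in lborel. x \<in> S \<longrightarrow> exp (- (m + p) * (s - t)) * g x \<le> reaction b \<kappa>' G' v x + p * v x)"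
    show "AE x in lborel. x \<in> S \<longrightarrow> exp (- (m + p) * h) * (u t x + h * g x) \<le> u (t + h) x"
    proof (rule AE_increment_exp_lower_bound[OF th(2), where u' = u'])
      fix s e :: real assume "t \<le> s" "s \<le> t + h" "e > 0"
      then show "\<exists>d>0. \<forall>r. \<bar>r - s\<bar> < d \<longrightarrow>
           (AE x in lborel. \<bar>u r x - u s x - (r - s) * u' s x\<bar> \<le> e * \<bar>r - s\<bar>)"
        using th by (intro u'(2)) auto
    next
      fix s assume s: "t \<le> s" "s \<le> t + h"
      then have "u s \<in> space_E k" "u' s \<in> space_E k"
        using uE[of s] u'(1)[of s] th by (auto simp: E_plus_def)
      then obtain C D where "AE x in lborel. \<bar>u s x\<bar> \<le> C" "AE x in lborel. \<bar>u' s x\<bar> \<le> D"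
        using space_E_bounded by metis
      then have "AE x in lborel. \<bar>u s x\<bar> \<le> max C D \<and> \<bar>u' s x\<bar> \<le> max C D"
        by eventually_elim auto
      then show "\<exists>C. AE x in lborel. \<bar>u s x\<bar> \<le> C \<and> \<bar>u' s x\<bar> \<le> C" by blast
    next
      fix s assume s: "t \<le> s" "s \<le> t + h"
      then have s0: "0 < s" using th by simp
      obtain v where v: "v \<in> E_plus k \<theta>'" "AE x in lborel. v x \<le> u s x"
        "AE x in lborel. x \<in> S \<longrightarrow> exp (- (m + p) * (s - t)) * g x \<le> reaction b \<kappa>' G' v x + p * v x"
        using hyp[OF s] by blast
      have vE: "v \<in> E_plus k \<theta>" by (rule E_plus_mono[OF v(1) assms(3)])
      have us: "u s \<in> E_plus k \<theta>" using uE s0 by simp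
      have "leE k v (u s)" using vE us v(2) by (intro leE_AE_I) (auto simp: E_plus_def)
      from leE_imp_AE[OF p0(2)[OF vE us this]] leE_imp_AE[OF comp[OF v(1)]] v(2,3) u'(3)[OF s0]
      show "AE x in lborel. x \<in> S \<longrightarrow> exp (- (m + p) * (s - t)) * g x \<le> u' s x + (m + p) * u s x"
      proof eventually_elim
        case (elim x)
        have "(p - p0) * v x \<le> (p - p0) * u s x" using elim p by (intro mult_left_mono) auto
        then have "reaction b \<kappa>' G' v x + p * v x \<le> u' s x + (m + p) * u s x"
          using elim(1,2) unfolding elim(5) by (simp add: algebra_simps)
        then show ?case using elim(4) by linarith
      qed
    qed
  qed
  then show ?thesis ..
qed

lemma solution_persists:
  fixes u :: "real \<Rightarrow> real ^ 'd \<Rightarrow> real"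
  assumes "0 < m" "0 < \<theta>'" "\<theta>' \<le> \<theta>"
    and cond: "basic_conditions k m a \<kappa> G \<theta>"
    and b: "prob_kernel b" "maps_E k G'" "all_conditions k m b \<kappa>' G' \<theta>'"
    and comp: "\<And>w. w \<in> E_plus k \<theta>' \<Longrightarrow> leE k (reaction b \<kappa>' G' w) (reaction a \<kappa> G w)"
    and u0: "u0 \<in> E_plus k \<theta>" "not_identically_zero k u0"
    and sol: "classical_solution k m a \<kappa> G u0 u" and uE: "\<And>t. t \<ge> 0 \<Longrightarrow> u t \<in> E_plus k \<theta>"
    and K: "compact K"
  shows "ereal \<theta>' \<le> Liminf at_top (\<lambda>t. ess_inf_on k K (\<lambda>x. u t (x + t *\<^sub>R drift b \<kappa>')))"
proof (rule ereal_le_of_dense_below)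
  fix r assume r: "r < \<theta>'"
  obtain p where "growing_flow k m \<kappa>' \<theta>' p b G' u"
    using solution_growing_flow[OF assms(1-3) cond b comp sol uE] by blast
  then interpret growing_flow k m \<kappa>' \<theta>' p b G' u .
  obtain t1 \<delta> \<eta> x0 where "0 < t1" "0 < \<delta>" "0 < \<eta>" "AE x in lborel. x \<in> ball x0 \<delta> \<longrightarrow> \<eta> \<le> u t1 x"
    using initial_positive_ball[OF sol u0] .
  from persists_below_\<theta>[OF this r] have pers: "persists r" .
  obtain M where M: "K \<subseteq> ball 0 M" using K bounded_subset_ballD[OF compact_imp_bounded, of K 0] by blast
  define c where "c = drift b \<kappa>'"
  show "ereal r \<le> Liminf at_top (\<lambda>t. ess_inf_on k K (\<lambda>x. u t (x + t *\<^sub>R drift b \<kappa>')))"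
  proof (rule Liminf_bounded)
    have "\<forall>\<^sub>F t in at_top. AE x in lborel. x \<in> ball (t *\<^sub>R c) M \<longrightarrow> r \<le> u t x"
      using pers unfolding persists_def c_def by blast
    with eventually_ge_at_top[of 0]
    show "\<forall>\<^sub>F t in at_top. ereal r \<le> ess_inf_on k K (\<lambda>x. u t (x + t *\<^sub>R drift b \<kappa>'))"
      unfolding c_def[symmetric]
    proof eventually_elim
      case (elim t)
      have E: "u t \<in> space_E k" using uE[OF elim(1)] by (simp add: E_plus_def)
      show ?case
      proof (rule ess_inf_on_ge[where M = M])
        have [measurable]: "u t \<in> borel_measurable borel" by (rule space_E_measurable[OF E])
        show "(\<lambda>x. u t (x + t *\<^sub>R c)) \<in> borel_measurable borel" by measurable
        show "continuous_on UNIV (\<lambda>x. u t (x + t *\<^sub>R c))" if "k \<noteq> Linf"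
          by (rule continuous_on_compose2[OF space_E_continuous[OF E that]]) (auto intro!: continuous_intros)
        show "AE x in lborel. x \<in> ball 0 M \<longrightarrow> r \<le> u t (x + t *\<^sub>R c)"
          using AE_translate[OF elim(2), of "- (t *\<^sub>R c)"] by (simp add: dist_norm)
        show "K \<in> sets borel" using K by (simp add: borel_compact)
      qed (fact M)
    qed
  qed
qed

lemma solution_le_capacity:
  fixes u :: "real \<Rightarrow> real ^ 'd \<Rightarrow> real"
  assumes uE: "\<And>t. t \<ge> 0 \<Longrightarrow> u t \<in> E_plus k \<theta>" and K: "compact K" "nonnegligible k K"
  shows "Limsup at_top (\<lambda>t. ess_inf_on k K (\<lambda>x. u t (x + t *\<^sub>R c))) \<le> ereal \<theta>"
proof (rule Limsup_bounded)
  show "\<forall>\<^sub>F t in at_top. ess_inf_on k K (\<lambda>x. u t (x + t *\<^sub>R c)) \<le> ereal \<theta>"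
    using eventually_ge_at_top[of 0]
  proof eventually_elim
    case (elim t)
    have h: "holds_E k (\<lambda>x. u t x \<le> \<theta>)" using uE[OF elim] by (simp add: E_plus_def leE_def)
    have "holds_E k (\<lambda>x. u t (x + t *\<^sub>R c) \<le> \<theta>)"
    proof (cases "k = Linf")
      case True
      then show ?thesis using AE_translate[OF holds_E_imp_AE[OF h], of "- (t *\<^sub>R c)"] by simp
    next
      case False
      then show ?thesis using h by (cases k) auto
    qed
    then show ?case by (rule ess_inf_on_le[OF _ K(2)]) (use K(1) in \<open>simp add: borel_compact\<close>)
  qed
qed

theorem theorem2p7:
  fixes k :: space_kind
    and m \<kappa> \<theta> :: real
    and a u0 :: "real ^ 'd \<Rightarrow> real"
    and G :: "(real ^ 'd \<Rightarrow> real) \<Rightarrow> real ^ 'd \<Rightarrow> real"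
    and an :: "nat \<Rightarrow> real ^ 'd \<Rightarrow> real"
    and \<kappa>n \<theta>n :: "nat \<Rightarrow> real"
    and Gn :: "nat \<Rightarrow> (real ^ 'd \<Rightarrow> real) \<Rightarrow> real ^ 'd \<Rightarrow> real"
    and u :: "real \<Rightarrow> real ^ 'd \<Rightarrow> real"
    and K :: "(real ^ 'd) set"
  assumes "m > 0" and "\<kappa> > 0" and "\<theta> > 0"
    and "prob_kernel a"
    and "maps_E k G"
    and "basic_conditions k m a \<kappa> G \<theta>"
    and "\<And>n. n \<ge> 1 \<Longrightarrow> prob_kernel (an n)"
    and "\<And>n. n \<ge> 1 \<Longrightarrow> \<kappa>n n > 0"
    and "\<And>n. n \<ge> 1 \<Longrightarrow> maps_E k (Gn n)"
    and "\<And>n. n \<ge> 1 \<Longrightarrow> 0 < \<theta>n n \<and> \<theta>n n \<le> \<theta>"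
    and "\<And>n. n \<ge> 1 \<Longrightarrow> all_conditions k m (an n) (\<kappa>n n) (Gn n) (\<theta>n n)"
    and "\<And>n. n \<ge> 1 \<Longrightarrow> \<theta>n n \<ge> \<theta> - 1 / real n"
    and "\<And>n w. n \<ge> 1 \<Longrightarrow> w \<in> E_plus k (\<theta>n n) \<Longrightarrow>
           leE k (reaction (an n) (\<kappa>n n) (Gn n) w) (reaction a \<kappa> G w)"
    and "u0 \<in> E_plus k \<theta>" and "not_identically_zero k u0"
    and "classical_solution k m a \<kappa> G u0 u"
    and "\<And>t. t \<ge> 0 \<Longrightarrow> u t \<in> E_plus k \<theta>"
    and "compact K" and "nonnegligible k K"
  shows "(\<forall>n\<ge>1.
            ereal (\<theta> - 1 / real n)
              \<le> Liminf at_top (\<lambda>t. ess_inf_on k K (\<lambda>x. u t (x + t *\<^sub>R drift (an n) (\<kappa>n n)))) \<and>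
            Liminf at_top (\<lambda>t. ess_inf_on k K (\<lambda>x. u t (x + t *\<^sub>R drift (an n) (\<kappa>n n))))
              \<le> Limsup at_top (\<lambda>t. ess_inf_on k K (\<lambda>x. u t (x + t *\<^sub>R drift (an n) (\<kappa>n n)))) \<and>
            Limsup at_top (\<lambda>t. ess_inf_on k K (\<lambda>x. u t (x + t *\<^sub>R drift (an n) (\<kappa>n n)))) \<le> ereal \<theta>) \<and>
         (\<forall>m' n0. n0 \<ge> 1 \<and> (\<forall>n\<ge>n0. drift (an n) (\<kappa>n n) = m') \<longrightarrow>
            ((\<lambda>t. ess_inf_on k K (\<lambda>x. u t (x + t *\<^sub>R m'))) \<longlongrightarrow> ereal \<theta>) at_top)"
proof -
  note asm = assms
  let ?I = "\<lambda>c t. ess_inf_on k K (\<lambda>x. u t (x + t *\<^sub>R c))"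
  have lower: "ereal (\<theta> - 1 / real n) \<le> Liminf at_top (?I (drift (an n) (\<kappa>n n)))" if n: "n \<ge> 1" for n
  proof -
    have "ereal (\<theta>n n) \<le> Liminf at_top (?I (drift (an n) (\<kappa>n n)))"
      using asm(10)[OF n]
      by (intro solution_persists[OF asm(1) _ _ asm(6) asm(7)[OF n] asm(9)[OF n] asm(11)[OF n]
            asm(13)[OF n] asm(14-18)]) auto
    moreover have "ereal (\<theta> - 1 / real n) \<le> ereal (\<theta>n n)" using asm(12)[OF n] by simp
    ultimately show ?thesis by (rule order.trans[rotated])
  qed
  have upper: "Limsup at_top (?I c) \<le> ereal \<theta>" for c
    by (rule solution_le_capacity[OF asm(17-19)])
  have mid: "Liminf at_top (?I c) \<le> Limsup at_top (?I c)" for c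
    by (rule Liminf_le_Limsup) simp
  have "(?I m' \<longlongrightarrow> ereal \<theta>) at_top"
    if n0: "n0 \<ge> 1" "\<forall>n\<ge>n0. drift (an n) (\<kappa>n n) = m'" for m' n0
  proof -
    have "ereal \<theta> \<le> Liminf at_top (?I m')"
    proof (rule ereal_le_of_dense_below)
      fix r assume "r < \<theta>"
      then obtain n1 where n1: "1 / real (Suc n1) < \<theta> - r" using nat_approx_posE[of "\<theta> - r"] by auto
      define n where "n = max n0 (Suc n1)"
      have n: "n \<ge> n0" "n \<ge> 1" "n \<ge> Suc n1" using n0 by (auto simp: n_def)
      have "1 / real n \<le> 1 / real (Suc n1)" using n(3) by (intro divide_left_mono) auto
      then have "ereal r \<le> ereal (\<theta> - 1 / real n)" using n1 by simp
      also have "\<dots> \<le> Liminf at_top (?I m')" using lower[OF n(2)] n0(2) n(1) by simp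
      finally show "ereal r \<le> Liminf at_top (?I m')" .
    qed
    then show ?thesis
      using mid[of m'] upper[of m']
      by (intro iffD2[OF tendsto_iff_Liminf_eq_Limsup]) (auto intro: antisym order.trans)
  qed
  then show ?thesis using lower upper mid by blast
qed

end
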